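(* Let $m\ge 4$ be an even integer. For $(a_1,\dots,a_{m-1})\in\mathbb{R}^{m-1}$ put $a_0=a_m=1$ and $g(t)=\sum_{i=0}^m a_it^{m-i}$. Let $$S=\{(a_1,\dots,a_{m-1})\in\mathbb{R}^{m-1}: g(t)>0\text{ for all }t\},$$ $$\bar S=\{(a_1,\dots,a_{m-1})\in\mathbb{R}^{m-1}: g(t)\ge 0\text{ for all }t\},$$ $$A=\{(a_1,\dots,a_{m-1})\in\mathbb{R}^{m-1}: g(t)=(t^2+ut+v)^2\phi(t),\ u^2<4v,\ \phi(t)\ge 0\text{ for all }t\}.$$ Then: (1) $\bar S$ is a closed convex set, $S$ is its interior, and $A\subset S$. (2) The dimension of $\bar S$ and $S$ is $m-1$, while the dimension of $A$ is $m-3$. (3) The discriminant $\Delta(g)$ is equal to zero on $A$ and on the boundary of $\bar S$, and has the same sign at the other part of $\bar S$.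
   Context: Here $t$ ranges over the reals; in the definition of $A$, $u,v$ are real numbers and $\phi$ is a polynomial with real coefficients. $\Delta(g)$ denotes the discriminant of the degree-$m$ polynomial $g$. Interior and boundary are taken in $\mathbb{R}^{m-1}$. "The other part of $\bar S$" means the points of $\bar S$ that are neither in $A$ nor on the boundary of $\bar S$. The set $A$ is called the appendix of $\bar S$.
   Formalization: The clause A ⊂ S is false for even m ≥ 6 (e.g. (t²+1)²(t−1)² for m = 6); it is replaced by A ⊂ S̄ together with the inclusion in S of those points of A that have φ(t) > 0 for all t, a subset also shown to have dimension m−3. *)

theory Defs
  imports "HOL-Analysis.Analysis" "Subresultants.Resultant_Prelim"
begin

text \<open>
  The space of dimension \<open>m - 1\<close> is \<^typ>\<open>real ^ 'n\<close>, its coordinates being numbered by an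
  arbitrary bijection \<open>idx\<close> from \<open>{1..<m}\<close> onto \<open>'n\<close>: the entry \<open>a\<^sub>i\<close> of \<open>a\<close> is the component of \<open>a\<close>
  at \<open>idx i\<close>.  Such a bijection exists exactly if \<open>'n\<close> has \<open>m - 1\<close> elements.

  The component is written \<^const>\<open>vec_nth\<close> because the usual infix is also used for the vectors
  of the theory of resultants.
\<close>

definition ext_coeff :: "nat \<Rightarrow> (nat \<Rightarrow> 'n::finite) \<Rightarrow> real ^ 'n \<Rightarrow> nat \<Rightarrow> real" where
  "ext_coeff m idx a i = (if i = 0 \<or> i = m then 1 else vec_nth a (idx i))"

definition param_poly :: "nat \<Rightarrow> (nat \<Rightarrow> 'n::finite) \<Rightarrow> real ^ 'n \<Rightarrow> real poly" where
  "param_poly m idx a = (\<Sum>i=0..m. monom (ext_coeff m idx a i) (m - i))"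

definition pos_set :: "nat \<Rightarrow> (nat \<Rightarrow> 'n::finite) \<Rightarrow> (real ^ 'n) set" where
  "pos_set m idx = {a. \<forall>t. poly (param_poly m idx a) t > 0}"

definition nonneg_set :: "nat \<Rightarrow> (nat \<Rightarrow> 'n::finite) \<Rightarrow> (real ^ 'n) set" where
  "nonneg_set m idx = {a. \<forall>t. poly (param_poly m idx a) t \<ge> 0}"

text \<open>Since coefficient lists start with the constant term, \<open>[:v, u, 1:]\<close> is \<open>t\<^sup>2 + u t + v\<close>.\<close>

definition appendix :: "nat \<Rightarrow> (nat \<Rightarrow> 'n::finite) \<Rightarrow> (real ^ 'n) set" where
  "appendix m idx = {a. \<exists>u v \<phi>. param_poly m idx a = [:v, u, 1:]\<^sup>2 * \<phi> \<and> u\<^sup>2 < 4 * v \<and>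
                                (\<forall>t. poly \<phi> t \<ge> 0)}"

text \<open>
  The appendix is not contained in \<^const>\<open>pos_set\<close> when \<open>m \<ge> 6\<close>, because the cofactor may have
  real zeros (see \<open>appendix_not_subset_pos_set\<close> below).  The inclusion holds for the points that
  have a strictly positive cofactor.
\<close>

definition strict_appendix :: "nat \<Rightarrow> (nat \<Rightarrow> 'n::finite) \<Rightarrow> (real ^ 'n) set" where
  "strict_appendix m idx = {a. \<exists>u v \<phi>. param_poly m idx a = [:v, u, 1:]\<^sup>2 * \<phi> \<and> u\<^sup>2 < 4 * v \<and>
                                       (\<forall>t. poly \<phi> t > 0)}"

text \<open>
  The dimension of a semialgebraic set: the largest \<open>d\<close> such that the set contains a
  homeomorphic copy of Euclidean \<open>d\<close>-space (equivalently, of the open unit cube of dimension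
  \<open>d\<close>).  It is the largest dimension of a cell in any decomposition of the set into finitely many
  cells.  The affine dimension would not do, since the appendix is not flat.
\<close>

definition has_dimension :: "'a::topological_space set \<Rightarrow> nat \<Rightarrow> bool" where
  "has_dimension X d \<longleftrightarrow>
     (\<exists>f. embedding_map (Euclidean_space d) (top_of_set X) f) \<and>
     (\<forall>e>d. \<not> (\<exists>f. embedding_map (Euclidean_space e) (top_of_set X) f))"

definition discriminant :: "real poly \<Rightarrow> real" where
  "discriminant p =
     (-1) ^ (degree p * (degree p - 1) div 2) * resultant p (pderiv p) / lead_coeff p"

lemma param_poly_surj:
  fixes idx :: "nat \<Rightarrow> 'n::finite"
  assumes idx: "bij_betw idx {1..<m} UNIV"
    and p: "degree p = m" "lead_coeff p = 1" "coeff p 0 = 1"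
  shows "\<exists>a. param_poly m idx a = p"
proof
  define a :: "real ^ 'n" where "a = (\<chi> j. coeff p (m - the_inv_into {1..<m} idx j))"
  have inj: "inj_on idx {1..<m}" using idx by (simp add: bij_betw_def)
  have ext: "ext_coeff m idx a i = coeff p (m - i)" if "i \<le> m" for i
    using that p the_inv_into_f_f[OF inj, of i] by (auto simp: ext_coeff_def a_def)
  have "param_poly m idx a = (\<Sum>i=0..m. monom (coeff p (m - i)) (m - i))"
    unfolding param_poly_def by (rule sum.cong) (auto simp: ext)
  also have "\<dots> = (\<Sum>i\<le>m. monom (coeff p i) i)"
    by (rule sum.reindex_bij_witness[of _ "\<lambda>i. m - i" "\<lambda>i. m - i"]) auto
  also have "\<dots> = p"
    using poly_as_sum_of_monoms[of p] p by simp
  finally show "param_poly m idx a = p" .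
qed

lemma appendix_not_subset_pos_set:
  fixes idx :: "nat \<Rightarrow> 'n::finite"
  assumes m: "even m" "m \<ge> 6" and idx: "bij_betw idx {1..<m} UNIV"
  shows "\<not> appendix m idx \<subseteq> pos_set m idx"
proof
  assume sub: "appendix m idx \<subseteq> pos_set m idx"
  obtain k where k: "m = 6 + 2 * k"
    using m by (metis evenE even_add even_numeral le_Suc_ex)
  define \<phi> :: "real poly" where "\<phi> = [:-1, 1:]\<^sup>2 * [:1, 0, 1:] ^ k"
  define p where "p = [:1, 0, 1:]\<^sup>2 * \<phi>"
  have nz: "[:-1, 1::real:]\<^sup>2 \<noteq> 0" "[:1, 0, 1::real:] ^ k \<noteq> 0" "[:1, 0, 1::real:]\<^sup>2 \<noteq> 0"
    by simp_all
  have "degree p = m"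
    unfolding p_def \<phi>_def k using nz
    by (subst degree_mult_eq, simp, simp, subst degree_mult_eq) (auto simp: degree_power_eq)
  moreover have "lead_coeff p = 1"
    unfolding p_def \<phi>_def by (simp only: lead_coeff_mult lead_coeff_power) simp
  moreover have "coeff p 0 = 1"
    unfolding p_def \<phi>_def by (simp flip: poly_0_coeff_0)
  ultimately obtain a where a: "param_poly m idx a = p"
    using param_poly_surj[OF idx] by blast
  have "\<forall>t. poly \<phi> t \<ge> 0"
    by (auto simp: \<phi>_def)
  then have "a \<in> appendix m idx"
    unfolding appendix_def mem_Collect_eq using a p_def
    by (intro exI[of _ "0::real"] exI[of _ "1::real"] exI[of _ \<phi>]) simp
  moreover have "poly (param_poly m idx a) 1 = 0"
    by (simp add: a p_def \<phi>_def)
  ultimately show False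
    using sub unfolding pos_set_def by (metis (mono_tags) less_irrefl mem_Collect_eq subsetD)
qed

end

theory Submission
  imports Defs "Subresultants.Subresultant" "HOL-Computational_Algebra.Fundamental_Theorem_Algebra"
begin

text \<open>
  Over the complex numbers the resultant of a monic polynomial \<open>g\<close> and its derivative is the product
  of the values of \<open>g'\<close> at the roots of \<open>g\<close>.  If \<open>g\<close> is real without real roots, conjugate roots
  contribute \<open>\<bar>g'(z)\<bar>\<^sup>2\<close>, so the sign of the discriminant depends only on \<open>m\<close> unless some nonreal root
  is multiple, which means that the square of a definite quadratic divides \<open>g\<close>.

  The appendix is the image of a smooth map in \<open>m - 3\<close> variables.  It contains no copy of a larger
  Euclidean space: the inverse of such an embedding, approximated by a polynomial map, would carry
  a negligible set onto a set with interior points.  Near a point where the cofactor is prime to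
  the quadratic factor the smooth map is injective, which gives the lower bound.
\<close>

no_notation Matrix.scalar_prod (infix "\<bullet>" 70)
no_notation Matrix.vec_index (infixl "$" 100)

subsection \<open>Resultants and roots\<close>

text \<open>The resultant is the subresultant of index 0, so the Brown-Traub relations between the
  subresultants of \<open>f\<close>, \<open>g\<close> and those of \<open>g\<close>,
  \<open>h\<close> apply. A constant \<open>h\<close>, possibly zero, falls under a different
  relation than one of positive degree.\<close>

lemma resultant_euclid:
  fixes f g h :: "'a :: idom poly"
  assumes eq: "f + b * g = h" and fg: "degree g \<le> degree f" and gh: "degree h < degree g"
  shows "resultant f g
    = (-1) ^ (degree f * degree g) * lead_coeff g ^ (degree f - degree h) * resultant g h"
proof (cases "degree h = 0")
  case False
  from BT_lemma_1_12[OF eq fg, of 0] gh False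
  have "subresultant 0 f g = Polynomial.smult ((-1) ^ (degree f * degree g) * lead_coeff g ^ (degree f - degree h))
    (subresultant 0 g h)" by simp
  then show ?thesis by (simp add: subresultant_resultant)
next
  case True
  then obtain c where h: "h = [:c:]" by (auto elim: degree_eq_zeroE)
  from BT_lemma_1_13[OF eq fg] gh True
  have "subresultant 0 f g = Polynomial.smult ((-1) ^ (degree f * degree g) * lead_coeff g ^ degree f *
    c ^ (degree g - 1)) [:c:]" by (simp add: h)
  moreover have "c ^ degree g = c ^ (degree g - 1) * c"
    using gh by (metis not_less0 power_minus_mult neq0_conv)
  ultimately show ?thesis by (simp add: subresultant_resultant h)
qed

lemma poly_eq_prod_proots:
  fixes p :: "complex poly"
  shows "poly p x = lead_coeff p * (\<Prod>z\<in>#proots p. x - z)"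
proof -
  have "poly p x = poly (Polynomial.smult (lead_coeff p) (\<Prod>z\<in>#proots p. [:-z, 1:])) x"
    by (simp only: complex_poly_decompose_multiset)
  then show ?thesis by (simp add: poly_prod_mset image_mset.compositionality o_def)
qed

lemma prod_mset_const_power: "(\<Prod>x\<in>#M. c :: 'a :: comm_monoid_mult) = c ^ size M"
  by (induction M) auto

lemma prod_mset_image_uminus: "(\<Prod>x\<in>#M. - f x :: 'a :: comm_ring_1) = (-1) ^ size M * (\<Prod>x\<in>#M. f x)"
  by (induction M) (auto simp: algebra_simps)

text \<open>Both sides expand into the double product of the differences z - w over the roots of
  \<open>f\<close> and \<open>g\<close>; reversing all \<open>degree f * degree g\<close>
  differences produces the sign.\<close>

lemma prod_poly_proots_swap:
  fixes f g :: "complex poly"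
  shows "lead_coeff f ^ degree g * (\<Prod>z\<in>#proots f. poly g z)
    = (-1) ^ (degree f * degree g) * (lead_coeff g ^ degree f * (\<Prod>w\<in>#proots g. poly f w))"
proof -
  have "(\<Prod>z\<in>#proots f. poly g z)
      = lead_coeff g ^ degree f * (\<Prod>z\<in>#proots f. \<Prod>w\<in>#proots g. z - w)"
    unfolding poly_eq_prod_proots[of g] prod_mset.distrib
    by (simp add: prod_mset_const_power size_proots_complex)
  also have "(\<Prod>z\<in>#proots f. \<Prod>w\<in>#proots g. z - w) = (\<Prod>w\<in>#proots g. \<Prod>z\<in>#proots f. z - w)"
    by (rule prod_mset.swap)
  also have "\<dots> = (\<Prod>w\<in>#proots g. \<Prod>z\<in>#proots f. - (w - z))" by simp
  also have "\<dots> = (-1) ^ (degree f * degree g) * (\<Prod>w\<in>#proots g. \<Prod>z\<in>#proots f. w - z)"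
    unfolding prod_mset_image_uminus prod_mset.distrib
    by (simp add: prod_mset_const_power size_proots_complex power_mult)
  finally have 1: "lead_coeff f ^ degree g * (\<Prod>z\<in>#proots f. poly g z) =
    (-1) ^ (degree f * degree g) * lead_coeff f ^ degree g * lead_coeff g ^ degree f *
      (\<Prod>w\<in>#proots g. \<Prod>z\<in>#proots f. w - z)" by (simp add: mult_ac)
  have "(\<Prod>w\<in>#proots g. poly f w)
      = lead_coeff f ^ degree g * (\<Prod>w\<in>#proots g. \<Prod>z\<in>#proots f. w - z)"
    unfolding poly_eq_prod_proots[of f] prod_mset.distrib
    by (simp add: prod_mset_const_power size_proots_complex)
  with 1 show ?thesis by (simp add: mult_ac)
qed

text \<open>Induction along the Euclidean algorithm. The remainder agrees with \<open>f\<close> at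
  the roots of \<open>g\<close>, so the formula for \<open>g\<close> and the remainder becomes a
  product of values of \<open>f\<close> over the roots of \<open>g\<close>, and
  \<open>prod_poly_proots_swap\<close> moves it to the roots of \<open>f\<close>.\<close>

lemma resultant_eq_prod_proots:
  fixes f g :: "complex poly"
  shows "resultant f g = lead_coeff f ^ degree g * (\<Prod>z\<in>#proots f. poly g z)"
proof -
  have le: "resultant f g = lead_coeff f ^ degree g * (\<Prod>z\<in>#proots f. poly g z)"
    if "degree g \<le> degree f" for f g :: "complex poly"
    using that
  proof (induction "degree g" arbitrary: f g rule: less_induct)
    case less
    show ?case
    proof (cases "degree g = 0")
      case True
      then obtain c where "g = [:c:]" by (auto elim: degree_eq_zeroE)
      moreover have "poly [:c:] = (\<lambda>z. c)" by auto
      ultimately show ?thesis by (simp add: prod_mset_const_power size_proots_complex)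
    next
      case False
      define h where "h = f mod g"
      have g0: "g \<noteq> 0" using False by auto
      have h: "degree h < degree g" unfolding h_def using degree_mod_less[OF g0, of f] False by auto
      have eq: "f + (- (f div g)) * g = h"
        using div_mult_mod_eq[of f g] by (simp add: h_def algebra_simps)
      have roots: "(\<Prod>w\<in>#proots g. poly h w) = (\<Prod>w\<in>#proots g. poly f w)"
      proof (rule arg_cong[where f = prod_mset], rule image_mset_cong)
        fix w assume "w \<in># proots g"
        then have "poly g w = 0" using g0 by simp
        then show "poly h w = poly f w" by (simp flip: eq)
      qed
      have "resultant f g = (-1) ^ (degree f * degree g) * lead_coeff g ^ (degree f - degree h) *
          (lead_coeff g ^ degree h * (\<Prod>w\<in>#proots g. poly f w))"
        using resultant_euclid[OF eq less.prems h] less.hyps[OF h, of g] h roots by simp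
      also have "\<dots> = (-1) ^ (degree f * degree g) * (lead_coeff g ^ degree f *
          (\<Prod>w\<in>#proots g. poly f w))"
        using h less.prems by (simp add: power_add[symmetric])
      finally show ?thesis by (simp add: prod_poly_proots_swap[of f g])
    qed
  qed
  show ?thesis
  proof (cases "degree g \<le> degree f")
    case True
    then show ?thesis by (rule le)
  next
    case False
    then show ?thesis
      using le[of f g] resultant_swap[of f g] prod_poly_proots_swap[of f g] by simp
  qed
qed

lemma of_real_resultant_pderiv:
  fixes p :: "real poly"
  assumes "lead_coeff p = 1"
  shows "complex_of_real (resultant p (pderiv p))
    = (\<Prod>z\<in>#proots (map_poly of_real p). poly (pderiv (map_poly of_real p)) z)"
proof -
  have "complex_of_real (resultant p (pderiv p))
      = resultant (map_poly of_real p) (pderiv (map_poly complex_of_real p))"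
    by (simp add: of_real_hom.map_poly_pderiv[symmetric] of_real_hom.resultant_hom[symmetric])
  then show ?thesis using assms by (simp add: resultant_eq_prod_proots)
qed

text \<open>Multiple roots are sought over the complex numbers because a polynomial without real
  zeros may have a repeated conjugate pair, as happens on the appendix.\<close>

lemma resultant_pderiv_eq_0_iff:
  fixes p :: "real poly"
  assumes "lead_coeff p = 1"
  shows "resultant p (pderiv p) = 0 \<longleftrightarrow>
    (\<exists>z. poly (map_poly complex_of_real p) z = 0 \<and> poly (pderiv (map_poly complex_of_real p)) z = 0)"
proof -
  have "map_poly complex_of_real p \<noteq> 0" using assms by auto
  have "resultant p (pderiv p) = 0 \<longleftrightarrow>
      (\<Prod>z\<in>#proots (map_poly of_real p). poly (pderiv (map_poly complex_of_real p)) z) = 0"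
    by (simp only: of_real_resultant_pderiv[OF assms, symmetric] of_real_eq_0_iff)
  also have "\<dots> \<longleftrightarrow> (\<exists>z. poly (map_poly complex_of_real p) z = 0 \<and>
      poly (pderiv (map_poly complex_of_real p)) z = 0)"
    using \<open>map_poly complex_of_real p \<noteq> 0\<close> by (auto simp: prod_mset_zero_iff image_iff)
  finally show ?thesis .
qed

lemma poly_cnj_of_real:
  "poly (map_poly complex_of_real p) (cnj z) = cnj (poly (map_poly complex_of_real p) z)"
  by (induction p) (auto simp: map_poly_pCons)

lemma resultant_pderiv_pos:
  fixes p :: "real poly"
  assumes lc: "lead_coeff p = 1" and real: "\<And>t. poly p t \<noteq> 0"
    and simple: "resultant p (pderiv p) \<noteq> 0"
  shows "resultant p (pderiv p) > 0"
proof -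
  define P where "P = map_poly complex_of_real p"
  have dP: "pderiv P = map_poly complex_of_real (pderiv p)"
    by (simp add: P_def of_real_hom.map_poly_pderiv)
  have P0: "P \<noteq> 0" using lc by (auto simp: P_def)
  have ns: "poly (pderiv P) z \<noteq> 0" if "poly P z = 0" for z
    using that simple resultant_pderiv_eq_0_iff[OF lc] by (auto simp: P_def)
  define Z where "Z = {z. poly P z = 0}"
  have fin: "finite Z" unfolding Z_def using P0 by (rule poly_roots_finite)
  have rsq: "rsquarefree P" using ns by (auto simp: rsquarefree_roots)
  have "complex_of_real (resultant p (pderiv p)) = (\<Prod>z\<in>#proots P. poly (pderiv P) z)"
    using of_real_resultant_pderiv[OF lc] by (simp add: P_def)
  \<comment> \<open>All roots are simple, so every multiplicity is 1 and the multiset may be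
    replaced by the set \<open>Z\<close>.\<close>
  also have "\<dots> = (\<Prod>z\<in>Z. poly (pderiv P) z)"
  proof -
    have "(\<Prod>z\<in>#proots P. poly (pderiv P) z) = (\<Prod>z\<in>set_mset (proots P). poly (pderiv P) z ^ count (proots P) z)"
      by (rule image_prod_mset_multiplicity)
    also have "\<dots> = (\<Prod>z\<in>Z. poly (pderiv P) z)"
      using P0 rsq by (intro prod.cong) (auto simp: Z_def rsquarefree_root_order)
    finally show ?thesis .
  qed
  also have "\<dots> = (\<Prod>z\<in>{z\<in>Z. Im z > 0}. poly (pderiv P) z) * (\<Prod>z\<in>{z\<in>Z. Im z < 0}. poly (pderiv P) z)"
  proof -
    have "Z = {z\<in>Z. Im z > 0} \<union> {z\<in>Z. Im z < 0}"
    proof -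
      have "Im z \<noteq> 0" if "z \<in> Z" for z
      proof
        assume "Im z = 0"
        then obtain t where t: "z = of_real t" by (metis complex_is_Real_iff Reals_cases)
        have "poly P (of_real t) = of_real (poly p t)"
          by (simp add: P_def)
        then show False using that real[of t] t by (auto simp: Z_def)
      qed
      then show ?thesis by force
    qed
    moreover have "(\<Prod>z\<in>{z\<in>Z. Im z > 0} \<union> {z\<in>Z. Im z < 0}. poly (pderiv P) z) =
        (\<Prod>z\<in>{z\<in>Z. Im z > 0}. poly (pderiv P) z) * (\<Prod>z\<in>{z\<in>Z. Im z < 0}. poly (pderiv P) z)"
      using fin by (intro prod.union_disjoint) auto
    ultimately show ?thesis by simp
  qed
  \<comment> \<open>Conjugation exchanges the roots in the two half planes and commutes with the
    derivative, whose coefficients are real.\<close>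
  also have "(\<Prod>z\<in>{z\<in>Z. Im z < 0}. poly (pderiv P) z) = (\<Prod>z\<in>{z\<in>Z. Im z > 0}. cnj (poly (pderiv P) z))"
    by (rule prod.reindex_bij_witness[of _ cnj cnj]) (auto simp: Z_def P_def poly_cnj_of_real of_real_hom.map_poly_pderiv[symmetric])
  also have "(\<Prod>z\<in>{z\<in>Z. Im z > 0}. poly (pderiv P) z) * \<dots> = of_real (\<Prod>z\<in>{z\<in>Z. Im z > 0}. (cmod (poly (pderiv P) z))\<^sup>2)"
    by (simp add: prod.distrib[symmetric] complex_norm_square del: of_real_power)
  finally have "resultant p (pderiv p) = (\<Prod>z\<in>{z\<in>Z. Im z > 0}. (cmod (poly (pderiv P) z))\<^sup>2)"
    using of_real_eq_iff by blast
  then show ?thesis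
    by (auto intro!: prod_pos simp: Z_def ns)
qed

subsection \<open>Topological dimension\<close>

text \<open>For \<open>C\<close> contained in \<open>Basis\<close> this is the span of
  \<open>C\<close>. It models Euclidean space of dimension \<open>card C\<close> inside a fixed
  type, so that dimensions can vary while the type stays.\<close>

definition coord_space :: "'a::euclidean_space set \<Rightarrow> 'a set" where
  "coord_space C = {x. \<forall>i\<in>Basis - C. x \<bullet> i = 0}"

lemma subspace_coord_space: "subspace (coord_space C)"
  unfolding coord_space_def subspace_def by (auto simp: inner_add_left)

lemma Euclidean_space_eq_top_of_set: "Euclidean_space n = top_of_set {x. \<forall>i\<ge>n. x i = 0}"
  by (simp add: Euclidean_space_def euclidean_product_topology)

lemma coord_space_homeomorphic_Euclidean_space:
  fixes C :: "'a::euclidean_space set"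
  assumes C: "C \<subseteq> Basis"
  obtains f g where "homeomorphic_maps (Euclidean_space (card C)) (top_of_set (coord_space C)) f g"
proof -
  have finC: "finite C" using C finite_Basis finite_subset by blast
  obtain b where b: "bij_betw b {..<card C} C"
    using ex_bij_betw_nat_finite[OF finC] by (auto simp: atLeast0LessThan)
  define f :: "(nat \<Rightarrow> real) \<Rightarrow> 'a" where "f = (\<lambda>y. \<Sum>i<card C. y i *\<^sub>R b i)"
  \<comment> \<open>The value 0 from \<open>card C\<close> onwards makes \<open>g x\<close> a point
    of \<open>Euclidean_space (card C)\<close>.\<close>
  define g :: "'a \<Rightarrow> nat \<Rightarrow> real" where "g = (\<lambda>x i. if i < card C then x \<bullet> b i else 0)"
  have bC: "b i \<in> C" if "i < card C" for i using b that by (auto simp: bij_betw_def)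
  have bb: "b i \<bullet> b j = (if i = j then 1 else 0)" if "i < card C" "j < card C" for i j
    using that bC C b by (auto simp: inner_Basis bij_betw_def inj_on_def subset_iff)
  have fC: "f y \<in> coord_space C" for y
  proof -
    have "b i \<bullet> j = 0" if "i < card C" "j \<in> Basis - C" for i j
      using that bC[of i] C by (subst inner_Basis) auto
    then show ?thesis by (auto simp: f_def coord_space_def inner_sum_left)
  qed
  have gf: "g (f y) = y" if "\<forall>i\<ge>card C. y i = 0" for y
  proof
    fix i
    show "g (f y) i = y i"
      using that by (auto simp: g_def f_def inner_sum_left bb if_distrib[of "(*) _"] cong: if_cong)
  qed
  have fg: "f (g x) = x" if "x \<in> coord_space C" for x
  proof -
    have "f (g x) = (\<Sum>i<card C. (x \<bullet> b i) *\<^sub>R b i)" by (simp add: f_def g_def)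
    also have "\<dots> = (\<Sum>c\<in>C. (x \<bullet> c) *\<^sub>R c)" by (rule sum.reindex_bij_betw[OF b])
    also have "\<dots> = (\<Sum>c\<in>Basis. (x \<bullet> c) *\<^sub>R c)"
      using that C by (intro sum.mono_neutral_left) (auto simp: coord_space_def)
    finally show ?thesis by (simp add: euclidean_representation)
  qed
  have "homeomorphic_maps (Euclidean_space (card C)) (top_of_set (coord_space C)) f g"
    unfolding homeomorphic_maps_def
  proof (intro conjI ballI)
    have "continuous_on UNIV f" unfolding f_def
      by (intro continuous_intros continuous_on_product_coordinates)
    then show "continuous_map (Euclidean_space (card C)) (top_of_set (coord_space C)) f"
      by (auto simp: Euclidean_space_eq_top_of_set fC intro: continuous_on_subset)
    have "continuous_map (top_of_set (coord_space C)) (Euclidean_space (card C))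
      (\<lambda>x i. if i < card C then x \<bullet> b i else 0)"
      unfolding continuous_map_componentwise_Euclidean_space
      by (auto intro!: continuous_intros)
    then show "continuous_map (top_of_set (coord_space C)) (Euclidean_space (card C)) g"
      by (simp add: g_def)
  qed (auto simp: topspace_Euclidean_space gf fg)
  then show ?thesis by (rule that)
qed

text \<open>The radial contraction has the inverse y / (r - |y|) on the open ball of radius
  \<open>r\<close>. It lets a map that is controlled only on a compact ball give an embedding of the
  whole space.\<close>

lemma coord_space_shrink:
  fixes r :: real
  assumes r: "r > 0"
  shows "embedding_map (top_of_set (coord_space C)) (top_of_set (coord_space C \<inter> cball 0 r))
    (\<lambda>x. (r / (1 + norm x)) *\<^sub>R x)"
proof -
  let ?f = "\<lambda>x::'a. (r / (1 + norm x)) *\<^sub>R x" and ?g = "\<lambda>y::'a. (1 / (r - norm y)) *\<^sub>R y"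
  have pos: "1 + norm x > 0" "1 + norm x \<noteq> 0" for x :: 'a
    using norm_ge_zero[of x] by linarith+
  have nf: "norm (?f x) = r * norm x / (1 + norm x)" for x using r pos[of x] by simp
  have lt: "norm (?f x) < r" for x
    unfolding nf using r pos[of x] by (simp add: divide_simps algebra_simps)
  have gf: "?g (?f x) = x" for x
  proof -
    have "r - norm (?f x) = r / (1 + norm x)"
      unfolding nf using pos[of x] by (simp add: divide_simps algebra_simps)
    then have "?g (?f x) = (1 / (r / (1 + norm x)) * (r / (1 + norm x))) *\<^sub>R x" by simp
    also have "1 / (r / (1 + norm x)) * (r / (1 + norm x)) = 1"
      using r pos[of x] by simp
    finally show ?thesis by simp
  qed
  have cs: "?f x \<in> coord_space C" if "x \<in> coord_space C" for x
    using that subspace_coord_space by (rule subspace_scale[rotated])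
  have img: "?f ` coord_space C \<subseteq> coord_space C \<inter> cball 0 r"
    using cs lt by (auto simp: less_imp_le)
  have "homeomorphic_maps (top_of_set (coord_space C)) (top_of_set (?f ` coord_space C)) ?f ?g"
    unfolding homeomorphic_maps_def
  proof (intro conjI ballI)
    show "continuous_map (top_of_set (coord_space C)) (top_of_set (?f ` coord_space C)) ?f"
      by (auto intro!: continuous_intros simp: pos)
    have "?g \<in> ?f ` coord_space C \<rightarrow> coord_space C"
    proof
      fix y assume "y \<in> ?f ` coord_space C"
      then obtain x where "x \<in> coord_space C" "y = ?f x" by blast
      then show "?g y \<in> coord_space C" by (simp only: gf)
    qed
    moreover have "continuous_on (?f ` coord_space C) ?g"
    proof (intro continuous_intros ballI)
      fix y assume "y \<in> ?f ` coord_space C"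
      then obtain x where "y = ?f x" by blast
      then show "r - norm y \<noteq> 0" using lt[of x] by simp
    qed
    ultimately show "continuous_map (top_of_set (?f ` coord_space C)) (top_of_set (coord_space C)) ?g"
      by simp
  next
    fix y assume "y \<in> topspace (top_of_set (?f ` coord_space C))"
    then obtain x where "y = ?f x" by auto
    then show "?f (?g y) = y" by (simp only: gf)
  qed (rule gf)
  then have "homeomorphic_map (top_of_set (coord_space C)) (top_of_set (?f ` coord_space C)) ?f"
    using homeomorphic_map_maps by blast
  then show ?thesis
    using img unfolding embedding_map_def
    by (simp add: subtopology_subtopology Int_absorb1)
qed

text \<open>A compact piece of the parameter domain turns injectivity into an embedding.\<close>

lemma Euclidean_space_embeds:
  fixes F :: "'a::euclidean_space \<Rightarrow> 'b::euclidean_space"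
  assumes C: "C \<subseteq> Basis" and r: "r > 0"
    and cont: "continuous_on (cball a r) F" and inj: "inj_on F ((+) a ` coord_space C \<inter> cball a r)"
    and sub: "F ` ((+) a ` coord_space C \<inter> cball a r) \<subseteq> X"
  shows "\<exists>f. embedding_map (Euclidean_space (card C)) (top_of_set X) f"
proof -
  let ?D = "coord_space C \<inter> cball 0 r"
  obtain f g where "homeomorphic_maps (Euclidean_space (card C)) (top_of_set (coord_space C)) f g"
    using coord_space_homeomorphic_Euclidean_space[OF C] .
  then have 1: "embedding_map (Euclidean_space (card C)) (top_of_set (coord_space C)) f"
    using homeomorphic_map_maps surjective_embedding_map by blast
  have D: "a + x \<in> (+) a ` coord_space C \<inter> cball a r" if "x \<in> ?D" for x
    using that by (auto simp: dist_norm)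
  have "embedding_map (top_of_set ?D) (top_of_set X) (\<lambda>x. F (a + x))"
  proof (rule continuous_imp_embedding_map)
    have "continuous_on ?D (\<lambda>x. F (a + x))"
      by (rule continuous_on_compose2[OF cont]) (use D in \<open>auto intro!: continuous_intros\<close>)
    then show "continuous_map (top_of_set ?D) (top_of_set X) (\<lambda>x. F (a + x))"
      using D sub by (auto simp: image_subset_iff)
    show "compact_space (top_of_set ?D)"
      by (simp add: compact_space_subtopology closed_Int_compact closed_subspace subspace_coord_space)
    show "Hausdorff_space (top_of_set X)"
      by (simp add: Hausdorff_space_subtopology)
    show "inj_on (\<lambda>x. F (a + x)) (topspace (top_of_set ?D))"
    proof (rule inj_onI)
      fix x y assume "x \<in> topspace (top_of_set ?D)" "y \<in> topspace (top_of_set ?D)" "F (a + x) = F (a + y)"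
      then have "a + x = a + y" using inj_onD[OF inj _ D D, of x y] by simp
      then show "x = y" by simp
    qed
  qed
  then show ?thesis
    using embedding_map_compose[OF embedding_map_compose[OF 1 coord_space_shrink[OF r]]] by blast
qed

text \<open>This makes an abstract embedding usable in analysis, on a subspace of any convenient
  Euclidean type. A smaller \<open>card C\<close> is allowed since sequences vanishing from
  \<open>card C\<close> onwards also vanish from \<open>e\<close> onwards.\<close>

lemma embedding_Euclidean_space_injective:
  fixes X :: "'b::euclidean_space set" and C :: "'a::euclidean_space set"
  assumes emb: "embedding_map (Euclidean_space e) (top_of_set X) f"
    and C: "C \<subseteq> Basis" "card C \<le> e"
  obtains g where "continuous_on (coord_space C) g" "inj_on g (coord_space C)"
    "g ` coord_space C \<subseteq> X"
proof -
  obtain h k where hk: "homeomorphic_maps (Euclidean_space (card C)) (top_of_set (coord_space C)) h k"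
    using coord_space_homeomorphic_Euclidean_space[OF C(1)] .
  have hf: "homeomorphic_map (Euclidean_space e)
      (subtopology (top_of_set X) (f ` topspace (Euclidean_space e))) f"
    using emb unfolding embedding_map_def .
  have cf: "continuous_map (Euclidean_space e) (top_of_set X) f"
    using homeomorphic_imp_continuous_map[OF hf] unfolding continuous_map_in_subtopology by blast
  have injf: "inj_on f (topspace (Euclidean_space e))"
    using hf by (rule homeomorphic_imp_injective_map)
  have ck: "continuous_map (top_of_set (coord_space C)) (Euclidean_space (card C)) k"
    using hk by (simp add: homeomorphic_maps_def)
  have sub: "topspace (Euclidean_space (card C)) \<subseteq> topspace (Euclidean_space e)"
    using C(2) by simp
  have "continuous_map (top_of_set (coord_space C)) (Euclidean_space e) k"
    using ck sub by (auto simp: Euclidean_space_eq_top_of_set)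
  then have "continuous_map (top_of_set (coord_space C)) (top_of_set X) (f \<circ> k)"
    using cf by (rule continuous_map_compose)
  moreover have "inj_on (f \<circ> k) (coord_space C)"
  proof (rule comp_inj_on)
    show "inj_on k (coord_space C)"
      using hk by (intro inj_on_inverseI[of _ h]) (auto simp: homeomorphic_maps_def)
    have "k ` coord_space C \<subseteq> topspace (Euclidean_space (card C))"
      using ck by (auto simp: continuous_map_def)
    then show "inj_on f (k ` coord_space C)"
      using injf sub inj_on_subset by blast
  qed
  ultimately show ?thesis by (intro that[of "f \<circ> k"]) auto
qed

text \<open>An embedding would restrict to a continuous injection of
  \<open>'a \<times> real\<close>, which has one dimension more than \<open>'a\<close>, into
  \<open>'a\<close>. This contradicts invariance of dimension.\<close>

lemma no_embedding_larger_dimension: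
  fixes X :: "'a::euclidean_space set"
  assumes "e > DIM('a)"
  shows "\<not> embedding_map (Euclidean_space e) (top_of_set X) f"
proof
  assume emb: "embedding_map (Euclidean_space e) (top_of_set X) f"
  have le: "card (Basis :: ('a \<times> real) set) \<le> e" using assms by simp
  obtain g :: "'a \<times> real \<Rightarrow> 'a" where g: "continuous_on (coord_space Basis) g"
      "inj_on g (coord_space Basis)"
    by (rule embedding_Euclidean_space_injective[OF emb subset_refl le]) (rule that)
  have "coord_space (Basis :: ('a \<times> real) set) = UNIV" by (auto simp: coord_space_def)
  with g have "DIM('a \<times> real) \<le> DIM('a)"
    by (intro invariance_of_dimension[of UNIV g]) auto
  then show False by simp
qed

text \<open>
  A continuous left inverse of a putative embedding can be approximated by a polynomial map, whose
  image still has interior points by Brouwer's theorem; but the composition with a smooth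
  parametrisation by fewer variables has a negligible image.
\<close>

lemma no_embedding_differentiable_image:
  fixes F :: "'a::euclidean_space \<Rightarrow> 'b::euclidean_space"
  assumes C: "C \<subseteq> Basis" "card C < e" "card C < DIM('a)"
    and F: "F differentiable_on Y" and Y: "Y \<subseteq> coord_space C"
    and X: "X \<subseteq> F ` Y"
  shows "\<not> embedding_map (Euclidean_space e) (top_of_set X) f"
proof
  assume emb: "embedding_map (Euclidean_space e) (top_of_set X) f"
  define pr :: "'a set \<Rightarrow> 'a \<Rightarrow> 'a" where "pr = (\<lambda>D y. \<Sum>c\<in>D. (y \<bullet> c) *\<^sub>R c)"
  have pr_inner: "pr D y \<bullet> j = (if j \<in> D then y \<bullet> j else 0)" if "D \<subseteq> Basis" "j \<in> Basis" for D y j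
  proof -
    have fD: "finite D" using that(1) finite_Basis finite_subset by blast
    have "pr D y \<bullet> j = (\<Sum>c\<in>D. if c = j then y \<bullet> j else 0)"
      unfolding pr_def inner_sum_left using that by (intro sum.cong) (auto simp: inner_Basis subset_iff)
    then show ?thesis using fD by (simp add: sum.delta)
  qed
  have pr_norm: "norm (pr D y) \<le> norm y" if "D \<subseteq> Basis" for D y
    by (rule norm_le_componentwise) (use that in \<open>auto simp: pr_inner\<close>)
  have pr_eq: "pr D y = x" if "D \<subseteq> Basis" "x \<in> coord_space D" "\<And>c. c \<in> D \<Longrightarrow> y \<bullet> c = x \<bullet> c" for D x y
    by (rule euclidean_eqI) (use that in \<open>auto simp: pr_inner coord_space_def\<close>)
  \<comment> \<open>One extra direction suffices: the contradiction is reached on the subspace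
    \<open>V\<close> of dimension \<open>card C + 1\<close>, which is at most
    \<open>e\<close>.\<close>
  obtain i where i: "i \<in> Basis" "i \<notin> C"
    using C by (cases "Basis \<subseteq> C") auto
  define C' where "C' = insert i C"
  have finC: "finite C" using C(1) finite_Basis finite_subset by blast
  have C': "C' \<subseteq> Basis" "card C' \<le> e" using C i finC by (auto simp: C'_def)
  define V where "V = coord_space C'"
  have V: "subspace V" unfolding V_def by (rule subspace_coord_space)
  obtain g where g: "continuous_on V g" "inj_on g V" "g ` V \<subseteq> X"
    using embedding_Euclidean_space_injective[OF emb C'] unfolding V_def .
  define D where "D = V \<inter> cball 0 1"
  have D: "compact D" "convex D"
    unfolding D_def using V
    by (simp_all add: closed_Int_compact closed_subspace convex_Int subspace_imp_convex)
  have D_ne: "D \<noteq> {}"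
    using subspace_0[OF V] by (auto simp: D_def)
  have gD: "continuous_on D g" "inj_on g D" "g ` D \<subseteq> X"
    using g by (auto simp: D_def intro: continuous_on_subset inj_on_subset)
  obtain h where h: "homeomorphism D (g ` D) g h"
    using homeomorphism_compact[OF D(1) gD(1) refl gD(2)] by blast
  have K: "compact (g ` D)" using D(1) gD(1) by (rule compact_continuous_image[rotated])
  have hV: "h ` g ` D \<subseteq> V" using h by (auto simp: homeomorphism_def D_def)
  \<comment> \<open>\<open>P\<close> approximates the inverse of the embedding on a compact set; its
    values are kept in \<open>V\<close> so that Brouwer's theorem can be applied within
    \<open>V\<close>.\<close>
  obtain P where P: "polynomial_function P" "P ` g ` D \<subseteq> V"
      "\<And>x. x \<in> g ` D \<Longrightarrow> norm (h x - P x) < 1 / 2"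
    using Stone_Weierstrass_polynomial_function_subspace[OF K homeomorphism_cont2[OF h] _ V hV, of "1/2"]
    by (auto simp: image_subset_iff)
  \<comment> \<open>A fixed point x of x \<mapsto> y + (x - P (g x)) solves P (g x) = y. The two
    bounds 1/2 add up to the radius 1 of \<open>D\<close>, so this map sends \<open>D\<close> into
    itself.\<close>
  have onto: "\<exists>x\<in>D. P (g x) = y" if y: "y \<in> V" "norm y \<le> 1 / 2" for y
  proof -
    have "continuous_on D (\<lambda>x. y + (x - P (g x)))"
      using P(1) gD(1) by (intro continuous_intros continuous_on_compose2[OF continuous_on_polymonial_function[of P UNIV]]) auto
    moreover have "(\<lambda>x. y + (x - P (g x))) \<in> D \<rightarrow> D"
    proof
      fix x assume x: "x \<in> D"
      then have "h (g x) = x" using h by (simp add: homeomorphism_def)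
      then have "norm (x - P (g x)) < 1 / 2" using P(3)[of "g x"] x by simp
      then have "norm (y + (x - P (g x))) \<le> 1" using y norm_triangle_ineq[of y "x - P (g x)"] by linarith
      moreover have "y + (x - P (g x)) \<in> V"
        using y x P(2) V by (auto intro!: subspace_add subspace_diff simp: D_def)
      ultimately show "y + (x - P (g x)) \<in> D" by (simp add: D_def)
    qed
    ultimately obtain x where "x \<in> D" "y + (x - P (g x)) = x"
      using brouwer[OF D D_ne] by blast
    then show ?thesis by (intro bexI[of _ x]) (auto simp: algebra_simps)
  qed
  \<comment> \<open>Negligibility is measured in the whole space, where \<open>V\<close> itself may
    be negligible. Hence \<open>G\<close> applies \<open>P\<close> after \<open>F\<close> to the
    \<open>C\<close> part and leaves the coordinates outside \<open>C'\<close> alone. The coordinate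
    along \<open>i\<close> is frozen at 0, which puts \<open>N\<close> into a hyperplane.\<close>
  define N where "N = {y. y \<bullet> i = 0 \<and> pr C y \<in> Y}"
  define G where "G = (\<lambda>y. P (F (pr C y)) + (y - pr C' y))"
  have "ball 0 (1 / 2) \<subseteq> G ` N"
  proof
    fix z :: 'a assume z: "z \<in> ball 0 (1 / 2)"
    have "pr C' z \<in> V" using C' by (auto simp: V_def coord_space_def pr_inner)
    then obtain x where x: "x \<in> D" "P (g x) = pr C' z"
      using onto[of "pr C' z"] z pr_norm[of C' z] C' by fastforce
    then obtain w where w: "w \<in> Y" "g x = F w" using gD(3) X by blast
    have wC: "w \<in> coord_space C" using w Y by blast
    \<comment> \<open>The \<open>C'\<close> part of the preimage is the parameter that
      \<open>P\<close> after \<open>F\<close> sends to the \<open>C'\<close> part of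
      \<open>z\<close>; the remaining coordinates are those of \<open>z\<close>.\<close>
    define y where "y = w + (z - pr C' z)"
    have y: "y \<bullet> c = w \<bullet> c" if "c \<in> C'" for c
      using that C' subsetD[OF C'(1) that] by (auto simp: y_def inner_add_left inner_diff_left pr_inner)
    have "pr C y = w" using C wC y
      by (intro pr_eq) (auto simp: C'_def)
    moreover have "pr C' y = w" using C' wC y
      by (intro pr_eq) (auto simp: C'_def coord_space_def)
    moreover have "y \<bullet> i = 0" using wC i y[of i]
      by (auto simp: C'_def coord_space_def)
    ultimately show "z \<in> G ` N"
      using w x by (intro image_eqI[of _ _ y]) (auto simp: G_def N_def y_def)
  qed
  moreover have "negligible (G ` N)"
  proof (rule negligible_differentiable_image_negligible)
    show "negligible N"
      using negligible_standard_hyperplane[OF i(1), of 0] by (rule negligible_subset) (auto simp: N_def)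
    have lin: "linear (pr D)" for D
      unfolding pr_def by (intro linearI) (auto simp: inner_add_left scaleR_add_left sum.distrib scaleR_sum_right)
    have prd: "pr D differentiable_on S" for D S
      using lin by (simp add: linear_imp_differentiable_on)
    have "(\<lambda>y. F (pr C y)) differentiable_on N"
      using differentiable_on_compose[OF prd[of C N], of F] differentiable_on_subset[OF F, of "pr C ` N"]
      by (auto simp: N_def)
    then have "(\<lambda>y. P (F (pr C y))) differentiable_on N"
      by (rule differentiable_on_compose) (rule differentiable_on_polynomial_function[OF P(1)])
    then show "G differentiable_on N"
      unfolding G_def by (intro differentiable_on_add differentiable_on_diff prd differentiable_on_ident)
  qed simp
  ultimately have "negligible (ball (0 :: 'a) (1 / 2))" using negligible_subset by blast
  then show False using open_not_negligible[of "ball (0 :: 'a) (1 / 2)"] by simp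
qed

subsection \<open>The space of polynomials\<close>

interpretation of_real_poly_hom: map_poly_inj_idom_hom complex_of_real ..

text \<open>Positivity is uniform in the form p(t) \<ge> c (1 + t^n): the leading term dominates for
  large |t|, and compactness covers the rest. Since both polynomials are monic, only lower powers
  change, and each of them is bounded by 1 + t^n.\<close>

lemma pos_poly_perturb:
  fixes p :: "real poly"
  assumes ev: "even (degree p)" and lc: "lead_coeff p = 1" and pos: "\<And>t. poly p t > 0"
  obtains e where "e > 0"
    "\<And>q t. degree q = degree p \<Longrightarrow> lead_coeff q = 1 \<Longrightarrow>
      (\<And>i. i < degree p \<Longrightarrow> \<bar>coeff q i - coeff p i\<bar> < e) \<Longrightarrow> poly q t > 0"
proof -
  define n where "n = degree p"
  have pw: "\<bar>t\<bar> ^ n = t ^ n" for t :: real using ev by (simp add: n_def power_even_abs)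
  have split: "poly q t = t ^ n + (\<Sum>i<n. coeff q i * t ^ i)"
    if "degree q = n" "lead_coeff q = 1" for q :: "real poly" and t
    using that(2) unfolding poly_altdef that(1) lessThan_Suc_atMost[symmetric] sum.lessThan_Suc by simp
  have pw_le: "\<bar>t\<bar> ^ i \<le> 1 + t ^ n" if "i < n" for i and t :: real
  proof (cases "\<bar>t\<bar> \<le> 1")
    case True
    then have "\<bar>t\<bar> ^ i \<le> 1" by (simp add: power_le_one)
    moreover have "0 \<le> t ^ n" by (simp add: pw[of t, symmetric])
    ultimately show ?thesis by linarith
  next
    case False
    then have "\<bar>t\<bar> ^ i \<le> \<bar>t\<bar> ^ n" using that by (intro power_increasing) auto
    then show ?thesis by (simp add: pw)
  qed
  obtain c where c: "c > 0" "\<And>t. poly p t \<ge> c * (1 + t ^ n)"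
  proof (cases "n = 0")
    case True
    then have "poly p t = 1" for t using split[of p t] lc by (simp add: n_def)
    \<comment> \<open>In degree 0 the weight \<open>1 + t ^ n\<close> is 2 and the polynomial is 1,
      hence the constant 1/2.\<close>
    then show ?thesis using True by (intro that[of "1/2"]) auto
  next
    case False
    define M where "M = (\<Sum>i<n. \<bar>coeff p i\<bar>)"
    \<comment> \<open>Beyond \<open>R\<close> the lower terms amount to at most half of t^n, and t^n
      \<ge> 1 turns the remaining half into at least a quarter of 1 + t^n.\<close>
    define R where "R = 1 + 2 * M"
    have M0: "M \<ge> 0" unfolding M_def by (simp add: sum_nonneg)
    have big: "poly p t \<ge> 1/4 * (1 + t ^ n)" if t: "\<bar>t\<bar> \<ge> R" for t
    proof -
      have t1: "\<bar>t\<bar> \<ge> 1" "2 * M \<le> \<bar>t\<bar>" using t M0 by (auto simp: R_def)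
      have "\<bar>\<Sum>i<n. coeff p i * t ^ i\<bar> \<le> (\<Sum>i<n. \<bar>coeff p i\<bar> * \<bar>t\<bar> ^ (n - 1))"
        using t1 by (intro order_trans[OF sum_abs] sum_mono)
          (auto simp: abs_mult power_abs intro!: mult_left_mono power_increasing)
      also have "\<dots> = M * \<bar>t\<bar> ^ (n - 1)" by (simp add: M_def sum_distrib_right)
      also have "\<dots> \<le> \<bar>t\<bar> / 2 * \<bar>t\<bar> ^ (n - 1)" using t1 by (intro mult_right_mono) auto
      also have "\<dots> = t ^ n / 2" using False by (simp add: pw[of t, symmetric] power_eq_if[of "\<bar>t\<bar>" n])
      finally have "t ^ n / 2 \<le> poly p t" using split[of p t] lc by (simp add: n_def)
      have "t ^ n \<ge> 1" using t1 by (simp add: pw[of t, symmetric] one_le_power)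
      then have "1/4 * (1 + t ^ n) \<le> t ^ n / 2" by simp
      then show ?thesis using \<open>t ^ n / 2 \<le> poly p t\<close> by (rule order_trans)
    qed
    have nz: "1 + t ^ n > 0" for t :: real using zero_le_power[of "\<bar>t\<bar>" n] pw[of t] by simp
    have "continuous_on {-R..R} (\<lambda>t. poly p t / (1 + t ^ n))"
      using nz by (intro continuous_intros) (auto simp: less_imp_neq[THEN not_sym])
    moreover have "{-R..R} \<noteq> {}" using M0 by (simp add: R_def)
    ultimately obtain s where s: "\<forall>t\<in>{-R..R}. poly p s / (1 + s ^ n) \<le> poly p t / (1 + t ^ n)"
      using continuous_attains_inf[OF compact_Icc] by blast
    define c where "c = min (1/4) (poly p s / (1 + s ^ n))"
    have "c > 0" using pos nz by (simp add: c_def)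
    moreover have "poly p t \<ge> c * (1 + t ^ n)" for t
    proof (cases "\<bar>t\<bar> \<ge> R")
      case True
      have "c * (1 + t ^ n) \<le> 1/4 * (1 + t ^ n)"
        using nz[of t] unfolding c_def by (intro mult_right_mono min.cobounded1) auto
      then show ?thesis using big[OF True] by simp
    next
      case False
      then have "poly p s / (1 + s ^ n) \<le> poly p t / (1 + t ^ n)"
        by (intro s[rule_format]) auto
      then have "c \<le> poly p t / (1 + t ^ n)" unfolding c_def by (rule min.coboundedI2)
      then show ?thesis using nz[of t] by (simp add: pos_le_divide_eq)
    qed
    ultimately show ?thesis by (rule that)
  qed
  \<comment> \<open>Dividing by n + 1 makes the total error n e strictly smaller than
    \<open>c\<close>, also for n = 0.\<close>
  define e where "e = c / (n + 1)"
  show ?thesis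
  proof (rule that[of e])
    show "e > 0" using c by (simp add: e_def)
    fix q :: "real poly" and t :: real
    assume q: "degree q = degree p" "lead_coeff q = 1"
      and close: "\<And>i. i < degree p \<Longrightarrow> \<bar>coeff q i - coeff p i\<bar> < e"
    have nz: "1 + t ^ n > 0" using zero_le_power[of "\<bar>t\<bar>" n] pw[of t] by simp
    have "poly q t - poly p t = (\<Sum>i<n. (coeff q i - coeff p i) * t ^ i)"
      using split[of q t] split[of p t] q lc by (simp add: n_def sum_subtractf algebra_simps)
    also have "\<bar>\<dots>\<bar> \<le> (\<Sum>i<n. e * (1 + t ^ n))"
    proof (intro order_trans[OF sum_abs] sum_mono)
      fix i assume "i \<in> {..<n}"
      then have "\<bar>coeff q i - coeff p i\<bar> \<le> e" "\<bar>t\<bar> ^ i \<le> 1 + t ^ n"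
        using close[of i] pw_le[of i t] by (auto simp: n_def)
      then show "\<bar>(coeff q i - coeff p i) * t ^ i\<bar> \<le> e * (1 + t ^ n)"
        unfolding abs_mult power_abs by (intro mult_mono) auto
    qed
    also have "\<dots> = real n * e * (1 + t ^ n)" by simp
    also have "\<dots> < c * (1 + t ^ n)"
      using nz c by (intro mult_strict_right_mono) (auto simp: e_def field_simps)
    finally show "poly q t > 0" using c(2)[of t] by linarith
  qed
qed

text \<open>The quadratic is (t - z)(t - cnj z). The remainder modulo it is real of degree at most 1
  and vanishes at the nonreal number \<open>z\<close>, so it is zero.\<close>

lemma complex_root_quadratic_dvd:
  fixes p :: "real poly"
  assumes z: "poly (map_poly complex_of_real p) z = 0" and im: "Im z \<noteq> 0"
  shows "[:(cmod z)\<^sup>2, - 2 * Re z, 1:] dvd p"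
proof -
  define q where "q = [:(cmod z)\<^sup>2, - 2 * Re z, 1:]"
  define r where "r = p mod q"
  have q0: "q \<noteq> 0" by (simp add: q_def)
  have qz: "poly (map_poly complex_of_real q) z = 0"
    unfolding q_def cmod_power2
    by (simp add: map_poly_pCons complex_eq_iff power2_eq_square algebra_simps)
  have "map_poly complex_of_real p = map_poly of_real (p div q) * map_poly of_real q + map_poly of_real r"
    unfolding r_def by (simp flip: of_real_poly_hom.hom_mult of_real_poly_hom.hom_add)
  then have rz: "poly (map_poly complex_of_real r) z = 0" using z qz by simp
  have "degree r < 2"
    using degree_mod_less[OF q0, of p] by (auto simp: r_def q_def)
  then have r: "r = [:coeff r 0, coeff r 1:]"
    by (intro poly_eqI) (auto simp: coeff_pCons split: nat.split intro: coeff_eq_0)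
  have "of_real (coeff r 0) + z * of_real (coeff r 1) = 0"
    using rz by (subst (asm) r) (simp add: of_real_hom.map_poly_pCons_hom)
  then have "coeff r 1 = 0 \<and> coeff r 0 = 0" using im by (auto simp: complex_eq_iff)
  then have "r = 0" by (subst r) simp
  then show ?thesis unfolding r_def q_def by (rule mod_eq_0_iff_dvd[THEN iffD1])
qed

lemma pos_quadratic:
  fixes u v t :: real
  assumes "u\<^sup>2 < 4 * v"
  shows "poly [:v, u, 1:] t > 0"
proof -
  have "poly [:v, u, 1:] t = (t + u / 2)\<^sup>2 + (4 * v - u\<^sup>2) / 4"
    by (simp add: power2_eq_square field_simps)
  also have "\<dots> > 0" using assms by (intro add_nonneg_pos) auto
  finally show ?thesis .
qed

text \<open>For \<open>u\<^sup>2 < 4 * v\<close> this is the root of t^2 + u t + v in the upper half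
  plane. The explicit formula shows its continuous dependence on \<open>u\<close> and
  \<open>v\<close>.\<close>

definition quadratic_root :: "real \<Rightarrow> real \<Rightarrow> complex" where
  "quadratic_root u v = Complex (- u / 2) (sqrt (v - u\<^sup>2 / 4))"

lemma poly_quadratic_root:
  assumes "u\<^sup>2 < 4 * v"
  shows "poly (map_poly of_real [:v, u, 1:]) (quadratic_root u v) = 0"
proof -
  have "(sqrt (v - u\<^sup>2 / 4))\<^sup>2 = v - u\<^sup>2 / 4" using assms by simp
  then show ?thesis
    by (simp add: quadratic_root_def map_poly_pCons complex_eq_iff power2_eq_square field_simps)
qed

lemma Im_quadratic_root: "u\<^sup>2 < 4 * v \<Longrightarrow> Im (quadratic_root u v) \<noteq> 0"
  by (simp add: quadratic_root_def)

section \<open>Coefficient vectors and their polynomials\<close>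

locale coeff_space =
  fixes m :: nat and idx :: "nat \<Rightarrow> 'n::finite"
  assumes m: "m \<ge> 4" and even_m: "even m" and idx: "bij_betw idx {1..<m} UNIV"
begin

abbreviation g :: "real ^ 'n \<Rightarrow> real poly" where "g \<equiv> param_poly m idx"

lemma CARD_n: "CARD('n) = m - 1"
  using bij_betw_same_card[OF idx] by simp

lemma idx_inj: "i \<in> {1..<m} \<Longrightarrow> j \<in> {1..<m} \<Longrightarrow> idx i = idx j \<longleftrightarrow> i = j"
  using idx by (auto simp: bij_betw_def inj_on_def)

lemma idx_cases: obtains i where "i \<in> {1..<m}" "j = idx i"
proof -
  have "j \<in> idx ` {1..<m}" using idx by (simp add: bij_betw_def)
  then show ?thesis using that by blast
qed

lemma coeff_g: "coeff (g a) k = (if k \<le> m then ext_coeff m idx a (m - k) else 0)"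
proof -
  have "coeff (g a) k = (\<Sum>i=0..m. if m - i = k then ext_coeff m idx a i else 0)"
    by (simp add: param_poly_def coeff_sum)
  also have "\<dots> = (\<Sum>i=0..m. if i = m - k \<and> k \<le> m then ext_coeff m idx a i else 0)"
    by (rule sum.cong) auto
  finally show ?thesis by (simp add: sum.delta)
qed

lemma coeff_g_mid: "0 < k \<Longrightarrow> k < m \<Longrightarrow> coeff (g a) k = a $ idx (m - k)"
  by (simp add: coeff_g ext_coeff_def)

lemma degree_g: "degree (g a) = m"
  by (rule antisym[OF degree_le le_degree]) (auto simp: coeff_g ext_coeff_def)

lemma monic_g: "lead_coeff (g a) = 1" and coeff_g_0: "coeff (g a) 0 = 1"
  by (simp_all only: degree_g) (simp_all add: coeff_g ext_coeff_def)

lemma g_inject: "g a = g b \<longleftrightarrow> a = b"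
proof
  assume eq: "g a = g b"
  have "a $ j = b $ j" for j
  proof -
    obtain i where i: "i \<in> {1..<m}" "j = idx i" by (rule idx_cases)
    then show ?thesis using coeff_g_mid[of "m - i" a] coeff_g_mid[of "m - i" b] eq by simp
  qed
  then show "a = b" by (simp add: Finite_Cartesian_Product.vec_eq_iff)
qed simp

lemma poly_g: "poly (g a) t = (\<Sum>i=0..m. ext_coeff m idx a i * t ^ (m - i))"
  by (simp add: param_poly_def poly_sum poly_monom)

section \<open>Closedness, convexity, interior and boundary\<close>

lemma closed_nonneg_set: "closed (nonneg_set m idx)"
proof -
  have "continuous_on UNIV (\<lambda>a. ext_coeff m idx a i)" for i
    by (cases "i = 0 \<or> i = m") (auto simp: ext_coeff_def intro!: continuous_intros)
  then show ?thesis
    unfolding nonneg_set_def poly_g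
    by (intro closed_Collect_all closed_Collect_le continuous_intros)
qed

lemma convex_nonneg_set: "convex (nonneg_set m idx)"
proof (rule convexI)
  fix a b :: "real ^ 'n" and u v :: real
  assume ab: "a \<in> nonneg_set m idx" "b \<in> nonneg_set m idx" and uv: "0 \<le> u" "0 \<le> v" "u + v = 1"
  \<comment> \<open>The prescribed outer coefficients 1 survive the combination because
    \<open>u + v = 1\<close>.\<close>
  have "ext_coeff m idx (u *\<^sub>R a + v *\<^sub>R b) i = u * ext_coeff m idx a i + v * ext_coeff m idx b i" for i
    using uv by (simp add: ext_coeff_def)
  then have "poly (g (u *\<^sub>R a + v *\<^sub>R b)) t = u * poly (g a) t + v * poly (g b) t" for t
    by (simp add: poly_g sum.distrib sum_distrib_left algebra_simps)
  then show "u *\<^sub>R a + v *\<^sub>R b \<in> nonneg_set m idx"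
    using ab uv by (simp add: nonneg_set_def)
qed

lemma open_pos_set: "open (pos_set m idx)"
  unfolding open_dist
proof
  fix a assume a: "a \<in> pos_set m idx"
  obtain e where e: "e > 0" "\<And>q t. degree q = degree (g a) \<Longrightarrow> lead_coeff q = 1 \<Longrightarrow>
      (\<And>i. i < degree (g a) \<Longrightarrow> \<bar>coeff q i - coeff (g a) i\<bar> < e) \<Longrightarrow> poly q t > 0"
    using pos_poly_perturb[of "g a"] a even_m by (auto simp: degree_g monic_g[unfolded degree_g] pos_set_def)
  have "b \<in> pos_set m idx" if b: "dist b a < e" for b
  proof -
    have "\<bar>coeff (g b) i - coeff (g a) i\<bar> < e" if "i < m" for i
    proof (cases "i = 0")
      case False
      have "\<bar>(b - a) $ idx (m - i)\<bar> \<le> norm (b - a)" by (rule component_le_norm_cart)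
      then show ?thesis using b that False by (simp add: coeff_g_mid dist_norm)
    qed (use e coeff_g_0 in simp)
    then show ?thesis unfolding pos_set_def using e(2)[of "g b"] degree_g monic_g by auto
  qed
  then show "\<exists>e>0. \<forall>b. dist b a < e \<longrightarrow> b \<in> pos_set m idx" using e(1) by blast
qed

lemma pos_set_subset: "pos_set m idx \<subseteq> nonneg_set m idx"
  by (auto simp: pos_set_def nonneg_set_def less_imp_le)

text \<open>At an interior point the coefficient of t^2 can be lowered by some e > 0 without losing
  nonnegativity, so g(t) \<ge> e t^2 > 0 for t \<noteq> 0. At t = 0 the value is the constant
  coefficient 1.\<close>

lemma interior_nonneg_set: "interior (nonneg_set m idx) = pos_set m idx"
proof
  show "pos_set m idx \<subseteq> interior (nonneg_set m idx)"
    using open_pos_set pos_set_subset by (rule interior_maximal[rotated])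
  show "interior (nonneg_set m idx) \<subseteq> pos_set m idx"
  proof
    fix a assume a: "a \<in> interior (nonneg_set m idx)"
    obtain e where e: "e > 0" "cball a e \<subseteq> nonneg_set m idx"
      using a by (auto simp: mem_interior_cball)
    define b where "b = a - e *\<^sub>R axis (idx (m - 2)) 1"
    have "b \<in> nonneg_set m idx" using e by (auto simp: b_def dist_norm)
    have "g b = g a - monom e 2"
    proof (rule poly_eqI)
      fix k
      consider "k = 0" | "k \<ge> m" | "0 < k" "k < m" by linarith
      then show "coeff (g b) k = coeff (g a - monom e 2) k"
      proof cases
        case 3
        moreover have "idx (m - 2) = idx (m - k) \<longleftrightarrow> 2 = k" using m 3 by (subst idx_inj) auto
        ultimately show ?thesis by (auto simp: coeff_g_mid b_def axis_def)
      qed (use m in \<open>auto simp: coeff_g ext_coeff_def\<close>)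
    qed
    then have *: "poly (g b) t = poly (g a) t - e * t\<^sup>2" for t by (simp add: poly_monom)
    have "poly (g a) t > 0" for t
    proof (cases "t = 0")
      case True
      then show ?thesis by (simp add: poly_0_coeff_0 coeff_g_0)
    next
      case False
      then have "e * t\<^sup>2 > 0" using e by simp
      moreover have "poly (g b) t \<ge> 0" using \<open>b \<in> nonneg_set m idx\<close> by (simp add: nonneg_set_def)
      ultimately show ?thesis using *[of t] by linarith
    qed
    then show "a \<in> pos_set m idx" by (simp add: pos_set_def)
  qed
qed

lemma frontier_nonneg_set: "frontier (nonneg_set m idx) = nonneg_set m idx - pos_set m idx"
  using closed_nonneg_set by (simp add: frontier_def interior_nonneg_set)

lemma appendix_subset: "appendix m idx \<subseteq> nonneg_set m idx"
proof
  fix a assume "a \<in> appendix m idx"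
  then obtain u v \<phi> where "g a = [:v, u, 1:]\<^sup>2 * \<phi>" "\<forall>t. poly \<phi> t \<ge> 0"
    by (auto simp: appendix_def)
  then show "a \<in> nonneg_set m idx" by (simp add: nonneg_set_def)
qed

lemma strict_appendix_subset: "strict_appendix m idx \<subseteq> pos_set m idx"
proof
  fix a assume "a \<in> strict_appendix m idx"
  then obtain u v \<phi> where *: "g a = [:v, u, 1:]\<^sup>2 * \<phi>" "u\<^sup>2 < 4 * v" "\<forall>t. poly \<phi> t > 0"
    by (auto simp: strict_appendix_def)
  have "poly (g a) t > 0" for t
    unfolding *(1) poly_mult poly_power using *(3) pos_quadratic[OF *(2), of t] by simp
  then show "a \<in> pos_set m idx" by (simp add: pos_set_def)
qed

section \<open>Zeros and sign of the discriminant\<close>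

lemma discriminant_g:
  "discriminant (g a) = (-1) ^ (m * (m - 1) div 2) * resultant (g a) (pderiv (g a))"
  by (simp add: discriminant_def degree_g monic_g[unfolded degree_g])

text \<open>The complex root of the squared quadratic factor is a root of \<open>g a\<close> and of
  its derivative.\<close>

lemma discriminant_appendix:
  assumes "a \<in> appendix m idx"
  shows "discriminant (g a) = 0"
proof -
  obtain u v \<phi> where *: "g a = [:v, u, 1:]\<^sup>2 * \<phi>" "u\<^sup>2 < 4 * v"
    using assms by (auto simp: appendix_def)
  define Q where "Q = map_poly complex_of_real [:v, u, 1:]"
  have "map_poly complex_of_real (g a) = Q\<^sup>2 * map_poly of_real \<phi>"
    unfolding * Q_def by (simp only: power2_eq_square of_real_poly_hom.hom_mult)
  moreover have "poly Q (quadratic_root u v) = 0"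
    unfolding Q_def using *(2) by (rule poly_quadratic_root)
  ultimately have "resultant (g a) (pderiv (g a)) = 0"
    by (subst resultant_pderiv_eq_0_iff[OF monic_g])
      (auto simp: pderiv_mult power2_eq_square intro!: exI[of _ "quadratic_root u v"])
  then show ?thesis by (simp add: discriminant_g)
qed

text \<open>A boundary polynomial is nonnegative and has a real zero; there it attains a minimum, so
  its derivative vanishes as well.\<close>

lemma discriminant_frontier:
  assumes "a \<in> frontier (nonneg_set m idx)"
  shows "discriminant (g a) = 0"
proof -
  have nonneg: "poly (g a) t \<ge> 0" for t
    using assms unfolding frontier_nonneg_set by (simp add: nonneg_set_def)
  obtain t where "\<not> poly (g a) t > 0"
    using assms unfolding frontier_nonneg_set by (auto simp: pos_set_def)
  then have t: "poly (g a) t = 0" using nonneg[of t] by simp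
  have "poly (pderiv (g a)) t = 0"
    by (rule DERIV_local_min[OF poly_DERIV, of 1])
      (use nonneg t in auto)
  with t have "resultant (g a) (pderiv (g a)) = 0"
    by (subst resultant_pderiv_eq_0_iff[OF monic_g])
      (auto simp: of_real_hom.map_poly_pderiv[symmetric] intro!: exI[of _ "of_real t"])
  then show ?thesis by (simp add: discriminant_g)
qed

text \<open>
  A nonreal double root contributes the square of an irreducible quadratic factor, so outside the
  appendix all roots are simple.
\<close>

lemma resultant_pos:
  assumes S: "a \<in> pos_set m idx" and A: "a \<notin> appendix m idx"
  shows "resultant (g a) (pderiv (g a)) > 0"
proof (rule resultant_pderiv_pos[OF monic_g])
  have pos: "poly (g a) t > 0" for t using S by (simp add: pos_set_def)
  then show "poly (g a) t \<noteq> 0" for t by (metis less_irrefl)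
  show "resultant (g a) (pderiv (g a)) \<noteq> 0"
  proof
    assume "resultant (g a) (pderiv (g a)) = 0"
    then obtain z where z: "poly (map_poly complex_of_real (g a)) z = 0"
        "poly (pderiv (map_poly complex_of_real (g a))) z = 0"
      using resultant_pderiv_eq_0_iff[OF monic_g] by blast
    have im: "Im z \<noteq> 0"
    proof
      assume "Im z = 0"
      then obtain t where "z = of_real t" by (metis complex_is_Real_iff Reals_cases)
      then show False using z(1) pos[of t] by simp
    qed
    define q where "q = [:(cmod z)\<^sup>2, - 2 * Re z, 1:]"
    obtain h where h: "g a = q * h"
      using complex_root_quadratic_dvd[OF z(1) im] unfolding q_def by (elim dvdE)
    have qz: "poly (map_poly complex_of_real q) z = 0"
      unfolding q_def cmod_power2
    by (simp add: map_poly_pCons complex_eq_iff power2_eq_square algebra_simps)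
    \<comment> \<open>As \<open>q\<close> vanishes at z, the derivative of the product there is
      q'(z) h(z), and q'(z) = 2 i Im z is nonzero. So z is also a root of \<open>h\<close>, and
      \<open>q\<close> can be split off once more.\<close>
    have q'z: "poly (pderiv (map_poly complex_of_real q)) z \<noteq> 0"
      using im by (simp add: q_def map_poly_pCons pderiv_pCons complex_eq_iff)
    have "poly (map_poly complex_of_real h) z = 0"
      using z(2) qz q'z by (simp add: h of_real_poly_hom.hom_mult pderiv_mult)
    then have "q dvd h" unfolding q_def using im by (rule complex_root_quadratic_dvd)
    then obtain \<phi> where \<phi>: "h = q * \<phi>" ..
    have eq: "g a = q\<^sup>2 * \<phi>" by (simp add: h \<phi> power2_eq_square)
    have disc: "(- 2 * Re z)\<^sup>2 < 4 * (cmod z)\<^sup>2" using im by (simp add: cmod_power2 power_mult_distrib)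
    have "poly \<phi> t \<ge> 0" for t
    proof -
      have "poly q t > 0" unfolding q_def by (rule pos_quadratic[OF disc])
      moreover have "(poly q t)\<^sup>2 * poly \<phi> t > 0" using pos[of t] by (simp add: eq)
      ultimately show ?thesis by (simp add: zero_less_mult_iff)
    qed
    then have "a \<in> appendix m idx"
      unfolding appendix_def mem_Collect_eq using eq disc q_def by blast
    then show False using A by blast
  qed
qed

end

subsection \<open>Parametrisation of the appendix\<close>

lemma differentiable_on_sum:
  fixes f :: "'i \<Rightarrow> 'a::real_normed_vector \<Rightarrow> 'b::real_normed_vector"
  assumes "finite I" "\<And>i. i \<in> I \<Longrightarrow> f i differentiable_on S"
  shows "(\<lambda>x. \<Sum>i\<in>I. f i x) differentiable_on S"
  using assms by (auto simp: differentiable_on_def intro!: differentiable_sum)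

lemma coeff_mult_differentiable_on:
  fixes P Q :: "'a::real_normed_vector \<Rightarrow> real poly"
  assumes "\<And>n. (\<lambda>y. coeff (P y) n) differentiable_on S" "\<And>n. (\<lambda>y. coeff (Q y) n) differentiable_on S"
  shows "(\<lambda>y. coeff (P y * Q y) n) differentiable_on S"
  unfolding coeff_mult by (intro differentiable_on_sum differentiable_on_mult assms finite_atMost)

lemma inverse_sqrt_differentiable_on:
  "(\<lambda>x::real. inverse (sqrt x)) differentiable_on {0<..}"
proof (rule differentiable_on_inverse)
  show "sqrt differentiable_on {0<..}"
  proof (rule differentiable_at_imp_differentiable_on)
    fix x :: real assume "x \<in> {0<..}"
    then show "sqrt differentiable at x"
      using DERIV_real_sqrt[of x] real_differentiable_def by blast
  qed
qed auto

lemma differentiable_on_vec_lambda: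
  fixes f :: "'a::real_normed_vector \<Rightarrow> 'n::finite \<Rightarrow> real"
  assumes "\<And>j. (\<lambda>y. f y j) differentiable_on S"
  shows "(\<lambda>y. \<chi> j. f y j) differentiable_on S"
proof -
  have "(\<lambda>y. \<chi> j. f y j) = (\<lambda>y. \<Sum>j\<in>UNIV. f y j *\<^sub>R axis j 1)"
    by (simp add: fun_eq_iff Finite_Cartesian_Product.vec_eq_iff axis_def if_distrib[of "(*) _"] cong: if_cong)
  then show ?thesis
    using assms by (auto intro!: differentiable_on_sum differentiable_on_scaleR)
qed

context coeff_space
begin

text \<open>
  The parameter \<open>y\<close> encodes the cofactor \<open>\<phi>\<close> of degree \<open>m - 4\<close> by its first \<open>m - 4\<close> entries and \<open>u\<close> by
  the next one; \<open>v\<close> is determined because \<open>v\<^sup>2 \<phi>(0) = 1\<close>.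
\<close>

definition cof :: "real ^ 'n \<Rightarrow> real poly" where
  "cof y = monom 1 (m - 4) + (\<Sum>j<m-4. monom (y $ idx (Suc j)) j)"

definition quad_u :: "real ^ 'n \<Rightarrow> real" where
  "quad_u y = y $ idx (m - 3)"

definition quad_v :: "real ^ 'n \<Rightarrow> real" where
  "quad_v y = inverse (sqrt (coeff (cof y) 0))"

definition quad :: "real ^ 'n \<Rightarrow> real poly" where
  "quad y = [:quad_v y, quad_u y, 1:]"

definition param_map :: "real ^ 'n \<Rightarrow> real ^ 'n" where
  "param_map y = (\<chi> j. coeff ((quad y)\<^sup>2 * cof y) (m - the_inv_into {1..<m} idx j))"

text \<open>The m - 3 parameters occupy these axes of the full space of dimension m - 1; the last
  two coordinates are zero on the parameter space. Source and target of \<open>param_map\<close>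
  thus have the same type.\<close>

definition param_coords :: "(real ^ 'n) set" where
  "param_coords = (\<lambda>i. axis (idx i) 1) ` {1..m - 3}"

lemma param_coords_subset: "param_coords \<subseteq> Basis"
  by (auto simp: param_coords_def axis_in_Basis_iff)

lemma card_param_coords: "card param_coords = m - 3"
proof -
  have "inj_on (\<lambda>i. axis (idx i) (1::real)) {1..m - 3}"
    using m by (intro inj_onI) (auto simp: axis_eq_axis idx_inj)
  then show ?thesis by (simp add: param_coords_def card_image)
qed

lemma mem_param_space_iff:
  "y \<in> coord_space param_coords \<longleftrightarrow> (\<forall>i. m - 3 < i \<and> i < m \<longrightarrow> y $ idx i = 0)"
proof
  assume y: "y \<in> coord_space param_coords"
  show "\<forall>i. m - 3 < i \<and> i < m \<longrightarrow> y $ idx i = 0"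
  proof (intro allI impI)
    fix i assume i: "m - 3 < i \<and> i < m"
    then have "axis (idx i) 1 \<in> (Basis :: (real ^ 'n) set) - param_coords"
      by (auto simp: param_coords_def axis_in_Basis_iff axis_eq_axis idx_inj)
    then have "y \<bullet> axis (idx i) 1 = 0" using y by (simp add: coord_space_def)
    then show "y $ idx i = 0" by (simp add: inner_axis)
  qed
next
  assume y: "\<forall>i. m - 3 < i \<and> i < m \<longrightarrow> y $ idx i = 0"
  show "y \<in> coord_space param_coords"
    unfolding coord_space_def
  proof (intro CollectI ballI)
    fix b :: "real ^ 'n" assume b: "b \<in> Basis - param_coords"
    then obtain j where j: "b = axis j 1" by (auto simp: Basis_vec_def)
    obtain i where i: "i \<in> {1..<m}" "j = idx i" by (rule idx_cases)
    have "i > m - 3" using b i j by (force simp: param_coords_def)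
    then show "y \<bullet> b = 0" using y i j by (simp add: inner_axis)
  qed
qed

lemma coeff_cof: "coeff (cof y) k = (if k < m - 4 then y $ idx (Suc k) else if k = m - 4 then 1 else 0)"
  by (simp add: cof_def coeff_sum)

lemma degree_cof: "degree (cof y) = m - 4"
  by (rule antisym[OF degree_le le_degree]) (auto simp: coeff_cof)

lemma monic_cof: "lead_coeff (cof y) = 1"
  unfolding degree_cof by (simp add: coeff_cof)

text \<open>The product is monic of degree \<open>m\<close>, and the choice of \<open>quad_v\<close>
  gives it the constant coefficient 1, so it is the polynomial of some vector.\<close>

lemma g_param_map:
  assumes "coeff (cof y) 0 > 0"
  shows "g (param_map y) = (quad y)\<^sup>2 * cof y"
proof -
  let ?p = "(quad y)\<^sup>2 * cof y"
  have nz: "quad y \<noteq> 0" "cof y \<noteq> 0" using monic_cof[of y] by (auto simp: quad_def)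
  have "degree ?p = m"
    using nz m by (simp add: degree_mult_eq degree_power_eq degree_cof) (simp add: quad_def)
  moreover have "lead_coeff ?p = 1"
    by (simp only: lead_coeff_mult lead_coeff_power monic_cof) (simp add: quad_def)
  moreover have "coeff ?p 0 = 1"
    using assms by (simp add: coeff_mult_0 coeff_0_power quad_def quad_v_def power_inverse)
  ultimately obtain a where a: "g a = ?p" using param_poly_surj[OF idx] by blast
  have "a = param_map y"
    unfolding Finite_Cartesian_Product.vec_eq_iff
  proof
    fix j
    obtain i where i: "i \<in> {1..<m}" "j = idx i" by (rule idx_cases)
    have "the_inv_into {1..<m} idx j = i"
      using i idx by (auto simp: bij_betw_def intro: the_inv_into_f_f)
    then have "param_map y $ j = coeff (g a) (m - i)" by (simp add: param_map_def a)
    also have "\<dots> = a $ j" using i by (simp add: coeff_g_mid)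
    finally show "a $ j = param_map y $ j" by simp
  qed
  with a show ?thesis by simp
qed

text \<open>It serves both to reach every point of the appendix and to choose the base point of the
  embedding.\<close>

lemma exists_param:
  assumes "degree \<phi> = m - 4" "lead_coeff \<phi> = 1"
  obtains y where "y \<in> coord_space param_coords" "cof y = \<phi>" "quad_u y = u"
proof -
  define y :: "real ^ 'n" where "y = (\<chi> j. let i = the_inv_into {1..<m} idx j in
    if i < m - 3 then coeff \<phi> (i - 1) else if i = m - 3 then u else 0)"
  have inj: "inj_on idx {1..<m}" using idx by (simp add: bij_betw_def)
  have y: "y $ idx i = (if i < m - 3 then coeff \<phi> (i - 1) else if i = m - 3 then u else 0)"
    if "i \<in> {1..<m}" for i
    unfolding y_def vec_lambda_beta the_inv_into_f_f[OF inj that] by (simp only: Let_def)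
  show ?thesis
  proof (rule that[of y])
    show "y \<in> coord_space param_coords" by (auto simp: mem_param_space_iff y)
    show "cof y = \<phi>"
    proof (rule poly_eqI)
      fix k
      show "coeff (cof y) k = coeff \<phi> k"
        using assms by (auto simp: coeff_cof y coeff_eq_0)
    qed
    show "quad_u y = u" using m by (simp add: quad_u_def y)
  qed
qed

text \<open>Comparing degrees and outer coefficients forces the cofactor to be monic of degree m - 4
  with v^2 \<phi>(0) = 1. Since v > 0, this determines v as 1 / sqrt(\<phi>(0)).\<close>

lemma appendix_subset_param_image:
  "appendix m idx \<subseteq> param_map ` {y \<in> coord_space param_coords. coeff (cof y) 0 > 0}"
proof
  fix a assume "a \<in> appendix m idx"
  then obtain u v \<phi> where a: "g a = [:v, u, 1:]\<^sup>2 * \<phi>" "u\<^sup>2 < 4 * v"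
    by (auto simp: appendix_def)
  have v: "v > 0" using a(2) zero_le_power2[of u] by linarith
  have nz: "\<phi> \<noteq> 0" using a(1) monic_g[of a] by auto
  have "degree (g a) = 4 + degree \<phi>"
    using nz unfolding a(1) by (subst degree_mult_eq) (auto simp: degree_power_eq)
  then have deg: "degree \<phi> = m - 4" by (simp add: degree_g)
  have "lead_coeff (g a) = lead_coeff \<phi>" unfolding a(1) lead_coeff_mult lead_coeff_power by simp
  then have lc: "lead_coeff \<phi> = 1" using monic_g by simp
  have c0: "v\<^sup>2 * coeff \<phi> 0 = 1"
    using coeff_g_0[of a] by (simp add: a(1) coeff_mult_0 coeff_0_power)
  obtain y where y: "y \<in> coord_space param_coords" "cof y = \<phi>" "quad_u y = u"
    using exists_param[OF deg lc] .
  have \<phi>0: "coeff \<phi> 0 = (inverse v)\<^sup>2" using c0 v by (simp add: field_simps)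
  have "quad_v y = v" using v by (simp add: quad_v_def y \<phi>0)
  then have "quad y = [:v, u, 1:]" by (simp add: quad_def y)
  moreover have pos: "coeff (cof y) 0 > 0" using v by (simp add: y \<phi>0)
  ultimately have "g (param_map y) = g a" by (simp add: g_param_map a(1) y)
  then have "a = param_map y" by (simp add: g_inject)
  then show "a \<in> param_map ` {y \<in> coord_space param_coords. coeff (cof y) 0 > 0}"
    using y pos by blast
qed

section \<open>Smoothness of the parametrization and bounds for the dimensions\<close>

lemma entry_differentiable_on: "(\<lambda>y :: real ^ 'n. y $ j) differentiable_on S"
  by (simp add: bounded_linear_imp_differentiable_on bounded_linear_vec_nth)

lemma cof_differentiable_on: "(\<lambda>y. coeff (cof y) k) differentiable_on S"
  by (cases "k < m - 4"; cases "k = m - 4") (simp_all add: coeff_cof entry_differentiable_on)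

lemma quad_v_differentiable_on: "quad_v differentiable_on {y. coeff (cof y) 0 > 0}"
proof -
  have "(\<lambda>y. inverse (sqrt (coeff (cof y) 0))) differentiable_on {y. coeff (cof y) 0 > 0}"
    by (rule differentiable_on_compose[OF cof_differentiable_on[of 0]])
      (rule differentiable_on_subset[OF inverse_sqrt_differentiable_on], auto)
  then show ?thesis by (simp add: quad_v_def[abs_def])
qed

lemma param_map_differentiable_on: "param_map differentiable_on {y. coeff (cof y) 0 > 0}"
proof -
  have "(\<lambda>y. coeff (quad y) n) differentiable_on {y. coeff (cof y) 0 > 0}" for n
  proof -
    consider "n = 0" | "n = 1" | "n = 2" | "n > 2" by linarith
    then show ?thesis
    proof cases
      case 1
      then show ?thesis using quad_v_differentiable_on by (simp add: quad_def)
    next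
      case 2
      then show ?thesis by (simp add: quad_def quad_u_def entry_differentiable_on)
    next
      case 3
      then show ?thesis by (simp add: quad_def numeral_2_eq_2)
    next
      case 4
      then have "(\<lambda>y. coeff (quad y) n) = (\<lambda>y. 0)"
        by (intro ext coeff_eq_0) (simp add: quad_def)
      then show ?thesis by simp
    qed
  qed
  then show ?thesis
    unfolding param_map_def[abs_def] power2_eq_square
    by (intro differentiable_on_vec_lambda coeff_mult_differentiable_on cof_differentiable_on)
qed

text \<open>The formulation for subsets covers the appendix and its strictly positive part at
  once.\<close>

lemma no_embedding_appendix:
  assumes "X \<subseteq> appendix m idx" "e > m - 3"
  shows "\<not> embedding_map (Euclidean_space e) (top_of_set X) f"
proof (rule no_embedding_differentiable_image)
  show "param_map differentiable_on {y \<in> coord_space param_coords. coeff (cof y) 0 > 0}"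
    using param_map_differentiable_on by (rule differentiable_on_subset) auto
  show "X \<subseteq> param_map ` {y \<in> coord_space param_coords. coeff (cof y) 0 > 0}"
    using assms(1) appendix_subset_param_image by blast
qed (use assms m param_coords_subset card_param_coords CARD_n in auto)

text \<open>The zero vector belongs to t^m + 1, which is positive for even \<open>m\<close>; a ball
  around it lies in the open set and contains a copy of the whole space.\<close>

lemma embedding_pos_set: "\<exists>f. embedding_map (Euclidean_space (m - 1)) (top_of_set (pos_set m idx)) f"
proof -
  have "poly (g 0) t > 0" for t
  proof -
    have "poly (g 0) t = (\<Sum>i\<in>{0, m}. t ^ (m - i))"
      unfolding poly_g by (rule sum.mono_neutral_cong_right) (auto simp: ext_coeff_def)
    also have "\<dots> = t ^ m + 1" using m by simp
    also have "\<dots> > 0" using even_m by (intro add_nonneg_pos) (auto simp: zero_le_even_power)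
    finally show ?thesis .
  qed
  then have "0 \<in> pos_set m idx" by (simp add: pos_set_def)
  then obtain r where r: "r > 0" "cball 0 r \<subseteq> pos_set m idx"
    using open_pos_set open_contains_cball by blast
  show ?thesis
    using Euclidean_space_embeds[OF subset_refl r(1), of "0 :: real ^ 'n" id "pos_set m idx"] r(2)
    by (auto simp: CARD_n continuous_on_id)
qed

text \<open>
  Near \<open>(t\<^sup>2 + t + 1)\<^sup>2 (t\<^sup>2 + 1)\<^sup>k\<close> the cofactor has no root in common with the quadratic factor, so the
  quadratic factor can be recovered from the product.
\<close>

lemma embedding_strict_appendix:
  "\<exists>f. embedding_map (Euclidean_space (m - 3)) (top_of_set (strict_appendix m idx)) f"
proof -
  obtain k where k: "m = 4 + 2 * k"
    using m even_m by (metis evenE even_add even_numeral le_Suc_ex)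
  define \<phi> :: "real poly" where "\<phi> = [:1, 0, 1:] ^ k"
  have deg: "degree \<phi> = m - 4" by (simp add: \<phi>_def degree_power_eq k)
  have lc: "lead_coeff \<phi> = 1" unfolding \<phi>_def lead_coeff_power by simp
  have pos: "poly \<phi> t > 0" for t
    using pos_quadratic[of 0 1 t] by (simp add: \<phi>_def)
  obtain y0 where y0: "y0 \<in> coord_space param_coords" "cof y0 = \<phi>" "quad_u y0 = 1"
    using exists_param[OF deg lc] .
  have c0: "coeff \<phi> 0 = 1" by (simp add: \<phi>_def coeff_0_power)
  have v0: "quad_v y0 = 1" by (simp add: quad_v_def y0 c0)
  define U where "U = {y. coeff (cof y) 0 > 0}"
  define z where "z = (\<lambda>y. quadratic_root (quad_u y) (quad_v y))"
  \<comment> \<open>\<open>H (y, y')\<close> tests the cofactor of \<open>y'\<close> at a root of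
    the quadratic of \<open>y\<close>. Two different parameters are needed, since injectivity
    compares two factorizations.\<close>
  define H where "H = (\<lambda>(y, y'). poly (map_poly complex_of_real (cof y')) (z y))"
  have cont_u: "continuous_on S quad_u" for S
    unfolding quad_u_def[abs_def] by (intro continuous_intros)
  have cont_cof: "continuous_on S (\<lambda>y. coeff (cof y) i)" for S i
    by (rule differentiable_imp_continuous_on[OF cof_differentiable_on])
  have cont_v: "continuous_on U quad_v"
    unfolding U_def by (rule differentiable_imp_continuous_on[OF quad_v_differentiable_on])
  have openU: "open U"
    unfolding U_def by (intro open_Collect_less continuous_on_const cont_cof)
  have cont_z: "continuous_on U z"
    unfolding z_def quadratic_root_def by (intro continuous_intros cont_u cont_v) auto
  have "continuous_on (U \<times> UNIV) H"
  proof -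
    have "H = (\<lambda>p. \<Sum>i\<le>m - 4. of_real (coeff (cof (snd p)) i) * z (fst p) ^ i)"
      by (auto simp: H_def poly_altdef degree_cof)
    moreover have "continuous_on (U \<times> UNIV) (\<lambda>p. \<Sum>i\<le>m - 4. of_real (coeff (cof (snd p)) i) * z (fst p) ^ i)"
      by (intro continuous_intros continuous_on_compose2[OF cont_cof[of UNIV]] continuous_on_compose2[OF cont_z]) auto
    ultimately show ?thesis by simp
  qed
  then have openW: "open ((U \<times> UNIV) \<inter> H -` (- {0}))"
    by (rule continuous_open_preimage) (auto intro: open_Times openU)
  \<comment> \<open>A root w of t^2 + t + 1 satisfies 1 + w^2 = -w \<noteq> 0, so it is not a root
    of the cofactor (t^2 + 1)^k.\<close>
  have "H (y0, y0) \<noteq> 0"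
  proof -
    define w where "w = z y0"
    have "poly (map_poly of_real [:1, 1, 1:]) w = 0"
      unfolding w_def z_def y0 v0 by (rule poly_quadratic_root) simp
    then have w: "1 + w * (1 + w) = 0" by (simp add: map_poly_pCons)
    then have "1 + w * w = - w" by (simp add: algebra_simps eq_neg_iff_add_eq_0)
    moreover have "w \<noteq> 0" using w by auto
    ultimately have "(1 + w * w) ^ k \<noteq> 0" by simp
    moreover have "map_poly complex_of_real \<phi> = [:1, 0, 1:] ^ k"
      unfolding \<phi>_def by (simp add: of_real_poly_hom.hom_power map_poly_pCons)
    ultimately show ?thesis by (simp add: H_def y0 flip: w_def)
  qed
  moreover have "y0 \<in> U" by (simp add: U_def y0 c0)
  ultimately have "(y0, y0) \<in> (U \<times> UNIV) \<inter> H -` (- {0})" by simp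
  then obtain B1 B2 where B: "open B1" "open B2" "y0 \<in> B1" "y0 \<in> B2"
      "B1 \<times> B2 \<subseteq> (U \<times> UNIV) \<inter> H -` (- {0})"
    using open_prod_elim[OF openW] by (metis mem_Sigma_iff)
  \<comment> \<open>Intersecting \<open>B1\<close> and \<open>B2\<close> makes \<open>H\<close>
    nonzero on all pairs from \<open>W\<close>; the last condition keeps the quadratics
    definite.\<close>
  define W where "W = B1 \<inter> B2 \<inter> (U \<inter> (\<lambda>y. 4 * quad_v y - (quad_u y)\<^sup>2) -` {0<..})"
  have "open (U \<inter> (\<lambda>y. 4 * quad_v y - (quad_u y)\<^sup>2) -` {0<..})"
    by (intro continuous_open_preimage openU continuous_intros cont_u cont_v)
  then have "open W" unfolding W_def using open_Int[OF B(1,2)] by (rule open_Int[rotated])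
  moreover have "y0 \<in> W"
    using B(3,4) \<open>y0 \<in> U\<close> by (simp add: W_def y0 v0)
  ultimately obtain r1 where r1: "r1 > 0" "cball y0 r1 \<subseteq> W"
    using open_contains_cball by blast
  obtain e where e: "e > 0" "\<And>q t. degree q = m - 4 \<Longrightarrow> lead_coeff q = 1 \<Longrightarrow>
      (\<And>i. i < m - 4 \<Longrightarrow> \<bar>coeff q i - coeff \<phi> i\<bar> < e) \<Longrightarrow> poly q t > 0"
  proof (rule pos_poly_perturb[of \<phi>])
    show "even (degree \<phi>)" using even_m by (simp add: deg)
    show "lead_coeff \<phi> = 1" by (rule lc)
    show "poly \<phi> t > 0" for t by (rule pos)
  qed (use that deg in simp)
  \<comment> \<open>The half of \<open>e\<close> turns the weak inequality on the closed ball into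
    the strict one required for positivity of the cofactor.\<close>
  define r where "r = min r1 (e / 2)"
  have r: "r > 0" using r1 e by (simp add: r_def)
  have inB: "y \<in> U" "(quad_u y)\<^sup>2 < 4 * quad_v y" if "y \<in> cball y0 r" for y
    using that subsetD[OF r1(2), of y] by (auto simp: r_def W_def)
  have H: "H (y, y') \<noteq> 0" if "y \<in> cball y0 r" "y' \<in> cball y0 r" for y y'
    using that subsetD[OF r1(2), of y] subsetD[OF r1(2), of y'] subsetD[OF B(5), of "(y, y')"]
    by (auto simp: r_def W_def)
  have gp: "g (param_map y) = (quad y)\<^sup>2 * cof y" if "y \<in> cball y0 r" for y
    using inB(1)[OF that] g_param_map by (simp add: U_def)
  have "\<exists>f. embedding_map (Euclidean_space (card param_coords)) (top_of_set (strict_appendix m idx)) f"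
  proof (rule Euclidean_space_embeds[OF param_coords_subset r])
    have "cball y0 r \<subseteq> {y. coeff (cof y) 0 > 0}" using inB(1) by (auto simp: U_def)
    then show "continuous_on (cball y0 r) param_map"
      using differentiable_imp_continuous_on[OF param_map_differentiable_on] continuous_on_subset by blast
    show "inj_on param_map ((+) y0 ` coord_space param_coords \<inter> cball y0 r)"
    proof (rule inj_onI)
      fix y y'
      assume y: "y \<in> (+) y0 ` coord_space param_coords \<inter> cball y0 r"
        and y': "y' \<in> (+) y0 ` coord_space param_coords \<inter> cball y0 r"
        and eq: "param_map y = param_map y'"
      have eq: "(quad y)\<^sup>2 * cof y = (quad y')\<^sup>2 * cof y'"
        using gp[of y] gp[of y'] y y' eq by simp
      have disc: "(quad_u y)\<^sup>2 < 4 * quad_v y" using inB y by blast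
      have root: "poly (map_poly complex_of_real (quad y)) (z y) = 0"
        unfolding quad_def z_def by (rule poly_quadratic_root[OF disc])
      have "poly (map_poly complex_of_real ((quad y)\<^sup>2 * cof y)) (z y) = 0"
        using root by (simp add: of_real_poly_hom.hom_mult power2_eq_square)
      \<comment> \<open>The common product vanishes at \<open>z y\<close> while the cofactor of
        \<open>y'\<close> does not. Two real monic quadratics sharing a nonreal root coincide, and
        cancelling their squares identifies the cofactors.\<close>
      then have "poly (map_poly complex_of_real (quad y')) (z y) = 0"
        using H[of y y'] y y' unfolding eq
        by (simp add: of_real_poly_hom.hom_mult power2_eq_square H_def)
      with root have "of_real (quad_v y') + z y * (of_real (quad_u y') + z y)
          = of_real (quad_v y) + z y * (of_real (quad_u y) + z y)"
        by (simp add: quad_def map_poly_pCons)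
      then have *: "of_real (quad_v y' - quad_v y) + z y * of_real (quad_u y' - quad_u y) = 0"
        by (simp add: algebra_simps)
      have "Im (z y) \<noteq> 0" unfolding z_def by (rule Im_quadratic_root[OF disc])
      moreover have "Im (z y) * (quad_u y' - quad_u y) = 0" using arg_cong[OF *, of Im] by simp
      ultimately have u: "quad_u y' = quad_u y" by simp
      with * have v: "quad_v y' = quad_v y" by (simp flip: of_real_diff)
      have "quad y' = quad y" by (simp add: quad_def u v)
      moreover have "quad y \<noteq> 0" by (simp add: quad_def)
      ultimately have cof: "cof y = cof y'" using eq by simp
      show "y = y'"
        unfolding Finite_Cartesian_Product.vec_eq_iff
      proof
        fix j
        obtain i where i: "i \<in> {1..<m}" "j = idx i" by (rule idx_cases)
        consider "i - 1 < m - 4" | "i = m - 3" | "m - 3 < i" using i by fastforce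
        then show "y $ j = y' $ j"
        proof cases
          case 1
          then show ?thesis
            using arg_cong[OF cof, of "\<lambda>p. coeff p (i - 1)"] i by (simp add: coeff_cof)
        next
          case 2
          then show ?thesis using u i by (simp add: quad_u_def)
        next
          case 3
          then show ?thesis using y y' i by (auto simp: mem_param_space_iff)
        qed
      qed
    qed
    show "param_map ` ((+) y0 ` coord_space param_coords \<inter> cball y0 r) \<subseteq> strict_appendix m idx"
    proof (rule image_subsetI)
      fix y assume "y \<in> (+) y0 ` coord_space param_coords \<inter> cball y0 r"
      then have y: "y \<in> cball y0 r" by blast
      have "poly (cof y) t > 0" for t
      proof (rule e(2)[OF degree_cof monic_cof])
        fix i assume i: "i < m - 4"
        have "\<bar>(y - y0) $ idx (Suc i)\<bar> \<le> norm (y - y0)" by (rule component_le_norm_cart)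
        also have "\<dots> < e" using y e(1) by (simp add: r_def dist_norm norm_minus_commute)
        finally show "\<bar>coeff (cof y) i - coeff \<phi> i\<bar> < e"
          using i by (simp add: coeff_cof flip: y0(2))
      qed
      then show "param_map y \<in> strict_appendix m idx"
        unfolding strict_appendix_def mem_Collect_eq
        using gp[OF y] inB(2)[OF y] quad_def by metis
    qed
  qed
  then show ?thesis by (simp add: card_param_coords)
qed

end

section \<open>Transfer of embeddings to larger sets and conclusion\<close>

lemma embedding_map_mono:
  assumes "\<exists>f. embedding_map X (top_of_set S) f" "S \<subseteq> T"
  shows "\<exists>f. embedding_map X (top_of_set T) f"
  using assms embedding_map_in_subtopology by (metis subset_trans)

theorem theorem6p1:
  fixes m :: nat and idx :: "nat \<Rightarrow> 'n::finite"
    and S Sbar A A_pos :: "(real ^ 'n) set"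
  assumes "m \<ge> 4" and "even m"
    and "bij_betw idx {1..<m} (UNIV :: 'n set)"
  defines "S \<equiv> pos_set m idx"
    and "Sbar \<equiv> nonneg_set m idx"
    and "A \<equiv> appendix m idx"
    and "A_pos \<equiv> strict_appendix m idx"
  shows "(closed Sbar \<and> convex Sbar \<and> interior Sbar = S \<and> A \<subseteq> Sbar \<and> A_pos \<subseteq> S) \<and>
    (has_dimension Sbar (m - 1) \<and> has_dimension S (m - 1) \<and>
      has_dimension A (m - 3) \<and> has_dimension A_pos (m - 3)) \<and>
    ((\<forall>a \<in> A \<union> frontier Sbar. discriminant (param_poly m idx a) = 0) \<and>
      ((\<forall>a \<in> Sbar - (A \<union> frontier Sbar). discriminant (param_poly m idx a) > 0) \<or>
       (\<forall>a \<in> Sbar - (A \<union> frontier Sbar). discriminant (param_poly m idx a) < 0)))"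
proof -
  interpret coeff_space m idx by unfold_locales (use assms(1-3) in auto)
  have App: "A_pos \<subseteq> A"
    unfolding A_def A_pos_def appendix_def strict_appendix_def by (blast intro: less_imp_le)
  \<comment> \<open>This is the upper bound for the two full-dimensional sets. The lower bounds for
    \<open>Sbar\<close> and \<open>A\<close> come from their subsets \<open>S\<close> and
    \<open>A_pos\<close>.\<close>
  have no: "\<not> embedding_map (Euclidean_space e) (top_of_set X) f" if "e > m - 1" for e f and X :: "(real ^ 'n) set"
    using that by (intro no_embedding_larger_dimension) (simp add: CARD_n)
  have dims: "has_dimension Sbar (m - 1) \<and> has_dimension S (m - 1) \<and>
      has_dimension A (m - 3) \<and> has_dimension A_pos (m - 3)"
    unfolding has_dimension_def
    using no embedding_pos_set embedding_map_mono[OF embedding_pos_set pos_set_subset]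
      embedding_strict_appendix embedding_map_mono[OF embedding_strict_appendix] App
      no_embedding_appendix[of A] no_embedding_appendix[of A_pos]
    unfolding S_def Sbar_def A_def A_pos_def by blast
  have sgn: "discriminant (g a) = (-1) ^ (m * (m - 1) div 2) * resultant (g a) (pderiv (g a)) \<and>
      resultant (g a) (pderiv (g a)) > 0" if "a \<in> Sbar - (A \<union> frontier Sbar)" for a
    using that resultant_pos[of a] discriminant_g
    by (auto simp: Sbar_def A_def frontier_nonneg_set)
  have "(\<forall>a \<in> Sbar - (A \<union> frontier Sbar). discriminant (g a) > 0) \<or>
       (\<forall>a \<in> Sbar - (A \<union> frontier Sbar). discriminant (g a) < 0)"
    \<comment> \<open>The resultant is positive at all these points, so the sign is that of the
      factor depending on \<open>m\<close> alone.\<close>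
    by (cases "even (m * (m - 1) div 2)") (use sgn in auto)
  then show ?thesis
    using closed_nonneg_set convex_nonneg_set interior_nonneg_set appendix_subset
      strict_appendix_subset dims discriminant_appendix discriminant_frontier
    unfolding S_def Sbar_def A_def A_pos_def by blast
qed

end
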